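(* Let $A$ be a ring. If $A$ is an SSP-ring, then $A$ is an almost multiplication ring.
   Context: All rings are commutative with $1$. An ideal $I$ is radical if $\sqrt{I}=I$ (the whole ring counts as a radical ideal). An SSP-ring is a ring in which every ideal is a (finite) product of radical ideals. A special primary ring is a ring $R$ with $\mathrm{Spec}(R)=\{M\}$ a single prime ideal and such that each proper ideal of $R$ is a power of $M$. An almost multiplication ring is a ring $A$ such that for every prime ideal $P$ of $A$ the localization $A_P$ is a discrete rank one valuation domain or a special primary ring. *)

theory Defs
  imports "HOL-Algebra.Ideal_Product"
begin

section \<open>Localization\<close>

text \<open>
  Rings of fractions with denominators in a submonoid \<open>S\<close> of a commutative ring \<open>R\<close>.
  Zero divisors in \<open>S\<close> (and \<open>\<zero> \<in> S\<close>) are allowed, hence the extra factor \<open>u\<close>.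
\<close>

definition frac_rel :: "('a, 'b) ring_scheme \<Rightarrow> 'a set \<Rightarrow> (('a \<times> 'a) \<times> ('a \<times> 'a)) set" where
  "frac_rel R S = {((a, s), (b, t)). a \<in> carrier R \<and> b \<in> carrier R \<and> s \<in> S \<and> t \<in> S \<and>
     (\<exists>u\<in>S. u \<otimes>\<^bsub>R\<^esub> (t \<otimes>\<^bsub>R\<^esub> a) = u \<otimes>\<^bsub>R\<^esub> (s \<otimes>\<^bsub>R\<^esub> b))}"

definition frac_class :: "('a, 'b) ring_scheme \<Rightarrow> 'a set \<Rightarrow> 'a \<Rightarrow> 'a \<Rightarrow> ('a \<times> 'a) set" where
  "frac_class R S a s = frac_rel R S `` {(a, s)}"

text \<open>
  The operations are given by the usual formulas on representatives; the unions range over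
  all choices of representatives, which yield the same class by \<open>mult_frac\<close> and \<open>add_frac\<close> below.
\<close>

definition localization :: "('a, 'b) ring_scheme \<Rightarrow> 'a set \<Rightarrow> ('a \<times> 'a) set ring" where
  "localization R S =
    \<lparr> carrier = (carrier R \<times> S) // frac_rel R S,
      mult = (\<lambda>X Y. \<Union>(a, s)\<in>X. \<Union>(b, t)\<in>Y. frac_class R S (a \<otimes>\<^bsub>R\<^esub> b) (s \<otimes>\<^bsub>R\<^esub> t)),
      one = frac_class R S \<one>\<^bsub>R\<^esub> \<one>\<^bsub>R\<^esub>,
      zero = frac_class R S \<zero>\<^bsub>R\<^esub> \<one>\<^bsub>R\<^esub>,
      add = (\<lambda>X Y. \<Union>(a, s)\<in>X. \<Union>(b, t)\<in>Y.
               frac_class R S ((t \<otimes>\<^bsub>R\<^esub> a) \<oplus>\<^bsub>R\<^esub> (s \<otimes>\<^bsub>R\<^esub> b)) (s \<otimes>\<^bsub>R\<^esub> t)) \<rparr>"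

definition localization_at :: "('a, 'b) ring_scheme \<Rightarrow> 'a set \<Rightarrow> ('a \<times> 'a) set ring" where
  "localization_at R P = localization R (carrier R - P)"

definition fraction_field :: "('a, 'b) ring_scheme \<Rightarrow> ('a \<times> 'a) set ring" where
  "fraction_field R = localization R (carrier R - {\<zero>\<^bsub>R\<^esub>})"

context cring
begin

context
  fixes S
  assumes S: "submonoid S R"
begin

lemma S_carr: "s \<in> S \<Longrightarrow> s \<in> carrier R"
  using submonoid.subset[OF S] by (rule subsetD)

lemma S_mult: "s \<in> S \<Longrightarrow> t \<in> S \<Longrightarrow> s \<otimes> t \<in> S"
  by (rule submonoid.m_closed[OF S])

lemma S_one: "\<one> \<in> S"
  by (rule submonoid.one_closed[OF S])

lemma equiv_frac_rel: "equiv (carrier R \<times> S) (frac_rel R S)"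
proof (rule equivI)
  show "frac_rel R S \<subseteq> (carrier R \<times> S) \<times> carrier R \<times> S"
    by (auto simp: frac_rel_def)
  show "refl_on (carrier R \<times> S) (frac_rel R S)"
    using S_one by (auto simp: refl_on_def frac_rel_def)
  show "sym (frac_rel R S)"
    unfolding sym_def frac_rel_def by (clarsimp, blast intro: sym)
  show "trans (frac_rel R S)"
  proof (rule transI, clarify)
    fix a s b t c r
    assume "((a, s), (b, t)) \<in> frac_rel R S" "((b, t), (c, r)) \<in> frac_rel R S"
    then obtain u v where carr: "a \<in> carrier R" "b \<in> carrier R" "c \<in> carrier R"
        and den: "s \<in> S" "t \<in> S" "r \<in> S" "u \<in> S" "v \<in> S"
        and u: "u \<otimes> (t \<otimes> a) = u \<otimes> (s \<otimes> b)" and v: "v \<otimes> (r \<otimes> b) = v \<otimes> (t \<otimes> c)"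
      by (auto simp: frac_rel_def)
    note [simp] = carr den[THEN S_carr]
    have "(u \<otimes> v \<otimes> t) \<otimes> (r \<otimes> a) = (v \<otimes> r) \<otimes> (u \<otimes> (t \<otimes> a))"
      by (simp add: m_ac)
    also have "\<dots> = (u \<otimes> s) \<otimes> (v \<otimes> (r \<otimes> b))"
      unfolding u by (simp add: m_ac)
    also have "\<dots> = (u \<otimes> v \<otimes> t) \<otimes> (s \<otimes> c)"
      unfolding v by (simp add: m_ac)
    finally show "((a, s), (c, r)) \<in> frac_rel R S"
      using carr den S_mult by (auto simp: frac_rel_def)
  qed
qed

lemma frac_eq_iff:
  assumes "a \<in> carrier R" "s \<in> S" "b \<in> carrier R" "t \<in> S"
  shows "frac_class R S a s = frac_class R S b t \<longleftrightarrow> (\<exists>u\<in>S. u \<otimes> (t \<otimes> a) = u \<otimes> (s \<otimes> b))"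
proof -
  have "frac_class R S a s = frac_class R S b t \<longleftrightarrow> ((a, s), (b, t)) \<in> frac_rel R S"
    unfolding frac_class_def by (rule eq_equiv_class_iff[OF equiv_frac_rel]) (use assms in simp_all)
  then show ?thesis
    using assms by (simp add: frac_rel_def)
qed

lemma carrier_localization:
  "carrier (localization R S) = {frac_class R S a s | a s. a \<in> carrier R \<and> s \<in> S}"
  by (auto simp: localization_def frac_class_def quotient_def)

lemma UN_frac:
  assumes a: "a \<in> carrier R" "s \<in> S" and b: "b \<in> carrier R" "t \<in> S"
    and cong: "\<And>a' s' b' t'. ((a, s), (a', s')) \<in> frac_rel R S \<Longrightarrow>
      ((b, t), (b', t')) \<in> frac_rel R S \<Longrightarrow> F a' s' b' t' = F a s b t"
  shows "(\<Union>(a', s')\<in>frac_class R S a s. \<Union>(b', t')\<in>frac_class R S b t. F a' s' b' t') = F a s b t"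
proof -
  have "(a, s) \<in> frac_class R S a s" "(b, t) \<in> frac_class R S b t"
    using a b equiv_class_self[OF equiv_frac_rel] by (auto simp: frac_class_def)
  moreover have "F a' s' b' t' = F a s b t"
    if "(a', s') \<in> frac_class R S a s" "(b', t') \<in> frac_class R S b t" for a' s' b' t'
    by (rule cong) (use that in \<open>simp_all add: frac_class_def\<close>)
  ultimately show ?thesis
    by (intro equalityI subsetI) (blast, blast)
qed

lemma mult_frac:
  assumes a: "a \<in> carrier R" "s \<in> S" and b: "b \<in> carrier R" "t \<in> S"
  shows "frac_class R S a s \<otimes>\<^bsub>localization R S\<^esub> frac_class R S b t = frac_class R S (a \<otimes> b) (s \<otimes> t)"
proof -
  have "frac_class R S (a' \<otimes> b') (s' \<otimes> t') = frac_class R S (a \<otimes> b) (s \<otimes> t)"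
    if rel: "((a, s), (a', s')) \<in> frac_rel R S" "((b, t), (b', t')) \<in> frac_rel R S" for a' s' b' t'
  proof -
    obtain u where a': "a' \<in> carrier R" and s: "s' \<in> S" "u \<in> S"
        and u: "u \<otimes> (s' \<otimes> a) = u \<otimes> (s \<otimes> a')"
      using rel(1) by (auto simp: frac_rel_def)
    obtain v where b': "b' \<in> carrier R" and t: "t' \<in> S" "v \<in> S"
        and v: "v \<otimes> (t' \<otimes> b) = v \<otimes> (t \<otimes> b')"
      using rel(2) by (auto simp: frac_rel_def)
    note den = s t
    note [simp] = a' b' a b den[THEN S_carr] a(2)[THEN S_carr] b(2)[THEN S_carr]
    have "(u \<otimes> v) \<otimes> ((s \<otimes> t) \<otimes> (a' \<otimes> b')) = (u \<otimes> (s \<otimes> a')) \<otimes> (v \<otimes> (t \<otimes> b'))"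
      by (simp add: m_ac)
    also have "\<dots> = (u \<otimes> v) \<otimes> ((s' \<otimes> t') \<otimes> (a \<otimes> b))"
      unfolding u[symmetric] v[symmetric] by (simp add: m_ac)
    finally show ?thesis
      using den S_mult by (subst frac_eq_iff) auto
  qed
  then show ?thesis
    unfolding localization_def ring_record_simps monoid.simps
    by (rule UN_frac[OF a b, of "\<lambda>a s b t. frac_class R S (a \<otimes> b) (s \<otimes> t)"])
qed

lemma add_frac:
  assumes a: "a \<in> carrier R" "s \<in> S" and b: "b \<in> carrier R" "t \<in> S"
  shows "frac_class R S a s \<oplus>\<^bsub>localization R S\<^esub> frac_class R S b t =
    frac_class R S ((t \<otimes> a) \<oplus> (s \<otimes> b)) (s \<otimes> t)"
proof -
  have "frac_class R S ((t' \<otimes> a') \<oplus> (s' \<otimes> b')) (s' \<otimes> t') = frac_class R S ((t \<otimes> a) \<oplus> (s \<otimes> b)) (s \<otimes> t)"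
    if rel: "((a, s), (a', s')) \<in> frac_rel R S" "((b, t), (b', t')) \<in> frac_rel R S" for a' s' b' t'
  proof -
    obtain u where a': "a' \<in> carrier R" and s: "s' \<in> S" "u \<in> S"
        and u: "u \<otimes> (s' \<otimes> a) = u \<otimes> (s \<otimes> a')"
      using rel(1) by (auto simp: frac_rel_def)
    obtain v where b': "b' \<in> carrier R" and t: "t' \<in> S" "v \<in> S"
        and v: "v \<otimes> (t' \<otimes> b) = v \<otimes> (t \<otimes> b')"
      using rel(2) by (auto simp: frac_rel_def)
    note den = s t
    note [simp] = a' b' a b den[THEN S_carr] a(2)[THEN S_carr] b(2)[THEN S_carr]
    have "(u \<otimes> v) \<otimes> ((s \<otimes> t) \<otimes> ((t' \<otimes> a') \<oplus> (s' \<otimes> b'))) =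
        (v \<otimes> t \<otimes> t') \<otimes> (u \<otimes> (s \<otimes> a')) \<oplus> (u \<otimes> s \<otimes> s') \<otimes> (v \<otimes> (t \<otimes> b'))"
      by (simp add: r_distr m_ac)
    also have "\<dots> = (u \<otimes> v) \<otimes> ((s' \<otimes> t') \<otimes> ((t \<otimes> a) \<oplus> (s \<otimes> b)))"
      unfolding u[symmetric] v[symmetric] by (simp add: r_distr m_ac)
    finally show ?thesis
      using den S_mult by (subst frac_eq_iff) auto
  qed
  then show ?thesis
    unfolding localization_def ring_record_simps monoid.simps
    by (rule UN_frac[OF a b, of "\<lambda>a s b t. frac_class R S ((t \<otimes> a) \<oplus> (s \<otimes> b)) (s \<otimes> t)"])
qed

lemma cring_localization: "cring (localization R S)"
proof -
  let ?L = "localization R S"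
  have one: "\<one>\<^bsub>?L\<^esub> = frac_class R S \<one> \<one>" and zero: "\<zero>\<^bsub>?L\<^esub> = frac_class R S \<zero> \<one>"
    by (simp_all add: localization_def)
  note [simp] = S_carr S_mult S_one one zero mult_frac add_frac
  have eq: "frac_class R S a s = frac_class R S b t"
    if "a \<in> carrier R" "s \<in> S" "b \<in> carrier R" "t \<in> S" "t \<otimes> a = s \<otimes> b" for a s b t
    using that S_one by (auto simp: frac_eq_iff)
  have ex: thesis
    if "x \<in> carrier ?L" "\<And>a s. x = frac_class R S a s \<Longrightarrow> a \<in> carrier R \<Longrightarrow> s \<in> S \<Longrightarrow> thesis" for x thesis
    using that by (auto simp: carrier_localization)
  have mem: "frac_class R S a s \<in> carrier ?L" if "a \<in> carrier R" "s \<in> S" for a s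
    using that by (auto simp: carrier_localization)
  show ?thesis
  proof (rule cringI)
    show "abelian_group ?L"
    proof (rule abelian_groupI)
      fix x assume "x \<in> carrier ?L"
      then show "\<exists>y\<in>carrier ?L. y \<oplus>\<^bsub>?L\<^esub> x = \<zero>\<^bsub>?L\<^esub>"
      proof (rule ex)
        fix a s assume x: "x = frac_class R S a s" "a \<in> carrier R" "s \<in> S"
        have "frac_class R S (\<ominus> a) s \<oplus>\<^bsub>?L\<^esub> x = \<zero>\<^bsub>?L\<^esub>"
          using x by (simp, intro eq) (simp_all add: r_minus l_neg)
        then show ?thesis
          using x mem by blast
      qed
    qed ((elim ex)?, simp add: mem; intro eq; simp add: r_distr m_ac a_ac)+
    show "comm_monoid ?L"
      by (rule comm_monoidI) ((elim ex)?, simp add: mem; intro eq; simp add: m_ac)+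
  qed ((elim ex)?, simp add: mem; intro eq; simp add: r_distr l_distr m_ac)+
qed

end

end


section \<open>Discrete rank one valuation domains\<close>

text \<open>
  Valuations are considered on the nonzero elements only, the value at zero (conventionally
  \<open>\<infinity>\<close>) being irrelevant. The value group is all of the integers, so the trivial valuation is
  excluded and no field is a discrete rank one valuation domain.
\<close>

definition discrete_valuation :: "('a, 'b) ring_scheme \<Rightarrow> ('a \<Rightarrow> int) \<Rightarrow> bool" where
  "discrete_valuation K v \<longleftrightarrow>
     (\<forall>x \<in> carrier K - {\<zero>\<^bsub>K\<^esub>}. \<forall>y \<in> carrier K - {\<zero>\<^bsub>K\<^esub>}.
        v (x \<otimes>\<^bsub>K\<^esub> y) = v x + v y \<and>
        (x \<oplus>\<^bsub>K\<^esub> y \<noteq> \<zero>\<^bsub>K\<^esub> \<longrightarrow> min (v x) (v y) \<le> v (x \<oplus>\<^bsub>K\<^esub> y))) \<and>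
     v ` (carrier K - {\<zero>\<^bsub>K\<^esub>}) = UNIV"

text \<open>
  A domain that, identified with the fractions with denominator \<open>\<one>\<close> in its field of fractions,
  is the valuation ring of a discrete valuation of that field.
\<close>

definition discrete_valuation_domain :: "('a, 'b) ring_scheme \<Rightarrow> bool" where
  "discrete_valuation_domain D \<longleftrightarrow> domain D \<and>
     (\<exists>v. discrete_valuation (fraction_field D) v \<and>
          (\<lambda>a. frac_class D (carrier D - {\<zero>\<^bsub>D\<^esub>}) a \<one>\<^bsub>D\<^esub>) ` carrier D =
          {x \<in> carrier (fraction_field D). x = \<zero>\<^bsub>fraction_field D\<^esub> \<or> 0 \<le> v x})"


section \<open>SSP-rings and almost multiplication rings\<close>

definition ideal_radical :: "('a, 'b) ring_scheme \<Rightarrow> 'a set \<Rightarrow> 'a set" where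
  "ideal_radical R I = {x \<in> carrier R. \<exists>n::nat. n \<ge> 1 \<and> x [^]\<^bsub>R\<^esub> n \<in> I}"

definition radical_ideal :: "'a set \<Rightarrow> ('a, 'b) ring_scheme \<Rightarrow> bool" where
  "radical_ideal I R \<longleftrightarrow> ideal I R \<and> ideal_radical R I = I"

text \<open>
  The empty product is the whole ring; as that is itself radical, allowing it changes nothing.
\<close>

definition SSP_ring :: "('a, 'b) ring_scheme \<Rightarrow> bool" where
  "SSP_ring R \<longleftrightarrow> cring R \<and>
     (\<forall>I. ideal I R \<longrightarrow>
       (\<exists>Js. (\<forall>J \<in> set Js. radical_ideal J R) \<and> I = foldr (ideal_prod R) Js (carrier R)))"

definition special_primary_ring :: "('a, 'b) ring_scheme \<Rightarrow> bool" where
  "special_primary_ring R \<longleftrightarrow> cring R \<and>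
     (\<exists>M. {P. primeideal P R} = {M} \<and>
       (\<forall>I. ideal I R \<and> I \<noteq> carrier R \<longrightarrow> (\<exists>n::nat. I = M [^]\<^bsub>ideals_set R\<^esub> n)))"

definition almost_multiplication_ring :: "('a, 'b) ring_scheme \<Rightarrow> bool" where
  "almost_multiplication_ring A \<longleftrightarrow> cring A \<and>
     (\<forall>P. primeideal P A \<longrightarrow>
        discrete_valuation_domain (localization_at A P) \<or>
        special_primary_ring (localization_at A P))"

end

theory Submission
  imports Defs "HOL-Algebra.QuotRing"
begin

text \<open>
  A localization of an SSP-ring is again an SSP-ring, so the theorem is about a local SSP-ring with
  maximal ideal \<open>M\<close>, the set of nonunits. The basic observation is that a proper ideal which
  is a product of two or more proper ideals lies in \<open>M\<^sup>2\<close>: every ideal of a local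
  SSP-ring is radical or contained in \<open>M\<^sup>2\<close> (\<open>SSP_radical_or_square\<close>). If, moreover, every
  nonunit has a power in \<open>I\<close>, then the only radical ideals above \<open>I\<close> are \<open>M\<close> and the
  whole ring, so \<open>I\<close> is a power of \<open>M\<close>. This settles the case where \<open>M\<close> is the only prime,
  in which the ring is special primary.

  The core of the proof is that prime ideals have no chains of length two
  (\<open>SSP_no_prime_chain\<close>). Dividing by the smallest prime reduces this to a domain with a nonzero prime
  \<open>P\<close> strictly contained in another prime. Localize at a prime \<open>Q\<close> minimal over
  \<open>P + (y)\<close> for some \<open>y\<close> outside \<open>P\<close>. There \<open>P + (y\<^sup>2)\<close> is a power of \<open>Q\<close> that does not
  contain \<open>y\<close>, which forces \<open>P \<subseteq> Q\<^sup>2\<close> (\<open>SSP_prime_subset_square\<close>). A nonzero principal ideal inside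
  \<open>P\<close> is a product of radical ideals; one of the factors lies in \<open>P\<close>, and it is principal
  because factors of nonzero principal ideals are invertible and the ring is local. So \<open>Q\<^sup>2\<close> contains a nonzero
  element generating a radical ideal. This is impossible (\<open>SSP_domain_radical_generator\<close>): write the
  element as a sum of products of finitely many nonunits and localize once more, at a prime minimal over
  these finitely many elements. The maximal ideal of that localization is principal
  (\<open>SSP_nonunits_principal\<close>, by Nakayama's lemma), and a square-free element cannot be a
  multiple of the square of its generator.

  It remains to treat a local SSP-ring with a prime different from \<open>M\<close>. By the absence of chains,
  all such primes lie in \<open>M\<^sup>2 \<noteq> M\<close>. An element \<open>z\<close> of \<open>M\<close> outside \<open>M\<^sup>2\<close> generates a
  radical ideal which lies in no prime but \<open>M\<close>, so \<open>M = (z)\<close>; and \<open>z\<close> is not nilpotent. Factoring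
  principal ideals again shows that every nonzero element is a unit times a power of \<open>z\<close>
  (\<open>SSP_unit_times_power\<close>), and the exponent of \<open>z\<close> is a discrete valuation.
\<close>

(* The sum of two ideals is written with the symbol that also denotes the disjoint sum of sets. *)
no_notation Sum_Type.Plus (infixr \<open><+>\<close> 65)

section \<open>Ideals, radicals and products\<close>

lemma (in cring) ideal_of_closed:
  assumes "I \<subseteq> carrier R" "\<zero> \<in> I"
    and add: "\<And>a b. a \<in> I \<Longrightarrow> b \<in> I \<Longrightarrow> a \<oplus> b \<in> I"
    and mult: "\<And>a x. a \<in> I \<Longrightarrow> x \<in> carrier R \<Longrightarrow> x \<otimes> a \<in> I"
  shows "ideal I R"
proof (rule idealI[OF ring_axioms])
  have neg: "\<ominus> a \<in> I" if "a \<in> I" for a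
    using mult[OF that, of "\<ominus> \<one>"] that assms(1) by (auto simp: l_minus)
  show "subgroup I (add_monoid R)"
    by (rule subgroup.intro) (use assms(1,2) add neg in \<open>auto simp: a_inv_def\<close>)
  fix a x assume "a \<in> I" "x \<in> carrier R"
  then show "x \<otimes> a \<in> I" "a \<otimes> x \<in> I"
    using mult[of a x] assms(1) m_comm[of a x] by auto
qed

lemma ideal_carrier: "ideal I R \<Longrightarrow> I \<subseteq> carrier R"
  by (auto dest: ideal.Icarr)

lemma mem_set_add: "x \<in> I <+>\<^bsub>R\<^esub> J \<longleftrightarrow> (\<exists>i\<in>I. \<exists>j\<in>J. x = i \<oplus>\<^bsub>R\<^esub> j)"
  by (auto simp: set_add_def')

lemma set_add_mono: "I \<subseteq> I' \<Longrightarrow> J \<subseteq> J' \<Longrightarrow> I <+>\<^bsub>R\<^esub> J \<subseteq> I' <+>\<^bsub>R\<^esub> J'"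
  by (fastforce simp: mem_set_add)

lemma (in cring) subset_set_add:
  assumes "ideal I R" "ideal J R"
  shows "I \<subseteq> I <+> J" "J \<subseteq> I <+> J"
  using union_genideal[OF assms] genideal_self[of "I \<union> J"] assms
  by (auto dest: ideal.Icarr)

lemma (in cring) set_add_subset:
  assumes "ideal K R" "I \<subseteq> K" "J \<subseteq> K"
  shows "I <+> J \<subseteq> K"
  using assms by (auto simp: mem_set_add subset_iff additive_subgroup.a_closed ideal.axioms(1))

lemma (in cring) mem_PIdl: "x \<in> PIdl a \<longleftrightarrow> (\<exists>r\<in>carrier R. x = r \<otimes> a)"
  by (auto simp: cgenideal_def)

lemma (in cring) ideal_prod_subset_ideal:
  assumes "ideal K R" "\<And>i j. i \<in> I \<Longrightarrow> j \<in> J \<Longrightarrow> i \<otimes> j \<in> K"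
  shows "I \<cdot> J \<subseteq> K"
proof
  fix x assume "x \<in> I \<cdot> J"
  then show "x \<in> K"
    by induct (use assms in \<open>auto simp: additive_subgroup.a_closed ideal.axioms(1)\<close>)
qed

lemma ideal_prod_mono:
  assumes "I \<subseteq> I'" "J \<subseteq> J'"
  shows "I \<cdot>\<^bsub>R\<^esub> J \<subseteq> I' \<cdot>\<^bsub>R\<^esub> J'"
proof
  fix x assume "x \<in> I \<cdot>\<^bsub>R\<^esub> J"
  then show "x \<in> I' \<cdot>\<^bsub>R\<^esub> J'"
    by induct (use assms in \<open>auto intro: ideal_prod.intros\<close>)
qed

lemma radical_ideal_is_ideal: "radical_ideal J R \<Longrightarrow> ideal J R"
  by (simp add: radical_ideal_def)

lemma (in cring) radical_idealD:
  assumes "radical_ideal J R" "x \<in> carrier R" "x [^] (n::nat) \<in> J"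
  shows "x \<in> J"
proof (cases "n = 0")
  case True
  then have "\<one> \<in> J" using assms by simp
  then show ?thesis
    using assms radical_ideal_is_ideal[OF assms(1)] ideal.one_imp_carrier by blast
next
  case False
  then have "n \<ge> 1" by simp
  then have "x \<in> ideal_radical R J" using assms(2,3) unfolding ideal_radical_def by blast
  then show ?thesis using assms by (simp add: radical_ideal_def)
qed

lemma (in cring) radical_idealI:
  assumes "ideal J R"
    and "\<And>x n::nat. x \<in> carrier R \<Longrightarrow> x [^] n \<in> J \<Longrightarrow> x \<in> J"
  shows "radical_ideal J R"
proof -
  have "x \<in> ideal_radical R J" if "x \<in> J" for x
    using that assms(1) by (auto simp: ideal_radical_def ideal.Icarr intro!: exI[of _ "1::nat"])
  then show ?thesis using assms by (auto simp: radical_ideal_def ideal_radical_def)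
qed

lemma (in cring) radical_ideal_carrier: "radical_ideal (carrier R) R"
  by (rule radical_idealI[OF oneideal])

abbreviation ideal_product :: "('a, 'b) ring_scheme \<Rightarrow> 'a set list \<Rightarrow> 'a set" where
  "ideal_product R Js \<equiv> foldr (ideal_prod R) Js (carrier R)"

lemma (in cring) ideal_product_ideal:
  assumes "\<And>J. J \<in> set Js \<Longrightarrow> ideal J R"
  shows "ideal (ideal_product R Js) R"
  using assms by (induct Js) (auto simp: oneideal ideal_prod_is_ideal)

lemma (in cring) ideal_product_subset:
  assumes "\<And>J. J \<in> set Js \<Longrightarrow> ideal J R" "J \<in> set Js"
  shows "ideal_product R Js \<subseteq> J"
  using assms
proof (induct Js)
  case (Cons K Js)
  have "K \<cdot> ideal_product R Js \<subseteq> K \<inter> ideal_product R Js"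
    using Cons by (intro ideal_prod_inter ideal_product_ideal) auto
  then show ?case using Cons by auto
qed simp

lemma (in cring) ideal_product_split:
  assumes "\<And>J. J \<in> set Js \<Longrightarrow> ideal J R" "J \<in> set Js"
  obtains K where "ideal K R" "ideal_product R Js = J \<cdot> K"
proof -
  have "\<exists>K. ideal K R \<and> ideal_product R Js = J \<cdot> K"
    using assms
  proof (induct Js)
    case (Cons L Js)
    let ?X = "ideal_product R Js"
    have L: "ideal L R" and X: "ideal ?X R" and J: "ideal J R"
      using Cons by (auto intro: ideal_product_ideal)
    show ?case
    proof (cases "J = L")
      case True
      then show ?thesis using X by auto
    next
      case False
      then obtain K where K: "ideal K R" "?X = J \<cdot> K" using Cons by auto
      have "L \<cdot> (J \<cdot> K) = J \<cdot> (L \<cdot> K)"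
        using J L K(1) by (metis ideal_prod_assoc ideal_prod_commute)
      then show ?thesis using K ideal_prod_is_ideal[OF L K(1)] by auto
    qed
  qed simp
  then show thesis using that by blast
qed

lemma (in cring) prime_contains_factor:
  assumes "primeideal P R" "\<And>J. J \<in> set Js \<Longrightarrow> ideal J R" "ideal_product R Js \<subseteq> P"
  shows "\<exists>J\<in>set Js. J \<subseteq> P"
  using assms(2,3)
proof (induct Js)
  case Nil
  then show ?case
    using primeideal.I_notcarr[OF assms(1)] ideal_carrier[OF primeideal.axioms(1)[OF assms(1)]] by simp
next
  case (Cons J Js)
  then have "ideal J R" "ideal (ideal_product R Js) R" by (auto intro: ideal_product_ideal)
  then show ?case
    using primeideal_divides_ideal_prod[OF assms(1)] Cons by auto
qed

lemma (in cring) SSP_ringE: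
  assumes "SSP_ring R" "ideal I R"
  obtains Js where "\<And>J. J \<in> set Js \<Longrightarrow> radical_ideal J R"
    "\<And>J. J \<in> set Js \<Longrightarrow> ideal J R" "\<And>J. J \<in> set Js \<Longrightarrow> I \<subseteq> J" "I = ideal_product R Js"
proof -
  obtain Js where Js: "\<forall>J\<in>set Js. radical_ideal J R" "I = ideal_product R Js"
    using assms unfolding SSP_ring_def by blast
  have "ideal J R" if "J \<in> set Js" for J using that Js radical_ideal_is_ideal by blast
  then show thesis using that[of Js] Js ideal_product_subset by blast
qed

section \<open>Minimal primes\<close>

text \<open>
  Minimality of \<open>N\<close> over \<open>I\<close> is expressed by the fact that, up to a factor outside \<open>N\<close>, each
  element of \<open>N\<close> is nilpotent modulo \<open>I\<close>. The prime is obtained as the complement of a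
  multiplicative set \<open>T\<close> that is maximal among those disjoint from \<open>I\<close>: enlarging \<open>T\<close> by any
  \<open>a\<close> outside it makes it meet \<open>I\<close>, which is exactly the stated property of \<open>a\<close>. That the complement is
  closed under addition follows from this property.
\<close>
lemma (in cring) minimal_prime_exists:
  assumes I: "ideal I R" and T0: "submonoid T\<^sub>0 R" "T\<^sub>0 \<inter> I = {}"
  obtains N where "primeideal N R" "I \<subseteq> N" "N \<inter> T\<^sub>0 = {}"
    "\<And>a. a \<in> N \<Longrightarrow> \<exists>s\<in>carrier R - N. \<exists>n::nat. s \<otimes> a [^] n \<in> I"
proof -
  let ?A = "{T. submonoid T R \<and> T\<^sub>0 \<subseteq> T \<and> T \<inter> I = {}}"
  have "\<exists>M\<in>?A. \<forall>X\<in>?A. M \<subseteq> X \<longrightarrow> X = M"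
  proof (rule subset_Zorn_nonempty)
    show "?A \<noteq> {}" using T0 by blast
    fix C assume C: "C \<noteq> {}" "subset.chain ?A C"
    have sub: "\<And>T. T \<in> C \<Longrightarrow> submonoid T R" and dir: "\<And>T T'. T \<in> C \<Longrightarrow> T' \<in> C \<Longrightarrow> T \<subseteq> T' \<or> T' \<subseteq> T"
      using C(2) by (auto simp: subset_chain_def)
    have "submonoid (\<Union>C) R"
    proof
      show "\<Union>C \<subseteq> carrier R" using sub submonoid.subset by blast
      show "\<one> \<in> \<Union>C" using sub C(1) submonoid.one_closed by blast
      fix x y assume "x \<in> \<Union>C" "y \<in> \<Union>C"
      then obtain T where "T \<in> C" "x \<in> T" "y \<in> T" using dir by blast
      then show "x \<otimes> y \<in> \<Union>C" using submonoid.m_closed[OF sub] by (meson UnionI)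
    qed
    moreover have "\<forall>T\<in>C. T\<^sub>0 \<subseteq> T \<and> T \<inter> I = {}"
      using C(2) by (auto simp: subset_chain_def)
    then have "T\<^sub>0 \<subseteq> \<Union>C" "\<Union>C \<inter> I = {}" using C(1) by blast+
    ultimately show "\<Union>C \<in> ?A" by blast
  qed
  then obtain T where TA: "T \<in> ?A" and TM: "\<forall>X\<in>?A. T \<subseteq> X \<longrightarrow> X = T"
    by (elim bexE)
  from TA have T: "submonoid T R" "T\<^sub>0 \<subseteq> T" "T \<inter> I = {}" by simp_all
  have max: "X = T" if "submonoid X R" "T \<subseteq> X" "X \<inter> I = {}" for X
    using TM that T(2) by simp
  note Tm = submonoid.m_closed[OF T(1)] and T1 = submonoid.one_closed[OF T(1)]
  have Tc: "\<And>s. s \<in> T \<Longrightarrow> s \<in> carrier R" using submonoid.subset[OF T(1)] by blast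
  have Tp: "s [^] (n::nat) \<in> T" if "s \<in> T" for s n
    using that by (induct n) (auto intro: Tm T1)
  have key: "\<exists>s\<in>T. \<exists>n::nat. s \<otimes> a [^] n \<in> I" if a: "a \<in> carrier R - T" for a
  proof (rule ccontr)
    assume neg: "\<not> ?thesis"
    let ?X = "{s \<otimes> a [^] n | s n::nat. s \<in> T}"
    have "submonoid ?X R"
    proof
      show "?X \<subseteq> carrier R" using a Tc by auto
      show "\<one> \<in> ?X" using T1 by (auto intro!: exI[of _ \<one>] exI[of _ "0::nat"])
      fix x y assume "x \<in> ?X" "y \<in> ?X"
      then obtain s m t n where st: "s \<in> T" "t \<in> T" "x = s \<otimes> a [^] (m::nat)" "y = t \<otimes> a [^] (n::nat)"
        by blast
      then have "x \<otimes> y = (s \<otimes> t) \<otimes> a [^] (m + n)"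
        using a Tc by (simp add: nat_pow_mult[symmetric] m_ac)
      then show "x \<otimes> y \<in> ?X" using st Tm by blast
    qed
    moreover have "T \<subseteq> ?X"
    proof
      fix s assume "s \<in> T"
      then have "s = s \<otimes> a [^] (0::nat)" using Tc by simp
      then show "s \<in> ?X" using \<open>s \<in> T\<close> by blast
    qed
    moreover have "a \<in> ?X" using a T1 by (auto intro!: exI[of _ \<one>] exI[of _ "1::nat"])
    ultimately show False using max[of ?X] neg a by blast
  qed
  \<comment> \<open>The ideal \<open>I'\<close> consists of the elements that become elements of \<open>I\<close> after inverting \<open>T\<close>.\<close>
  define I' where "I' = {x \<in> carrier R. \<exists>s\<in>T. s \<otimes> x \<in> I}"
  have I': "ideal I' R"
  proof (rule ideal_of_closed)
    show "\<zero> \<in> I'"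
      using T1 I by (auto simp: I'_def additive_subgroup.zero_closed ideal.axioms(1) intro!: bexI[of _ \<one>])
    show "I' \<subseteq> carrier R" by (auto simp: I'_def)
    fix a b assume "a \<in> I'" "b \<in> I'"
    then obtain s t where st: "s \<in> T" "t \<in> T" "s \<otimes> a \<in> I" "t \<otimes> b \<in> I" "a \<in> carrier R" "b \<in> carrier R"
      by (auto simp: I'_def)
    have "(s \<otimes> t) \<otimes> (a \<oplus> b) = t \<otimes> (s \<otimes> a) \<oplus> s \<otimes> (t \<otimes> b)"
      using st Tc by (simp add: r_distr m_ac)
    also have "\<dots> \<in> I"
      using st Tc I by (simp add: additive_subgroup.a_closed ideal.axioms(1) ideal.I_l_closed)
    finally show "a \<oplus> b \<in> I'" using st Tm by (auto simp: I'_def)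
  next
    fix a x assume "a \<in> I'" "x \<in> carrier R"
    then obtain s where s: "s \<in> T" "s \<otimes> a \<in> I" "a \<in> carrier R" "x \<in> carrier R" by (auto simp: I'_def)
    have "s \<otimes> (x \<otimes> a) = x \<otimes> (s \<otimes> a)" using s Tc by (simp add: m_ac)
    also have "\<dots> \<in> I" using s I by (simp add: ideal.I_l_closed)
    finally show "x \<otimes> a \<in> I'" using s by (auto simp: I'_def)
  qed
  have I'T: "x \<in> I'" if tx: "t \<otimes> x \<in> I'" "t \<in> T" "x \<in> carrier R" for t x
  proof -
    obtain s where "s \<in> T" "s \<otimes> (t \<otimes> x) \<in> I" using tx(1) by (auto simp: I'_def)
    then have "(s \<otimes> t) \<otimes> x \<in> I" "s \<otimes> t \<in> T" using tx Tc Tm by (auto simp: m_assoc)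
    then show ?thesis using tx(3) by (auto simp: I'_def)
  qed
  have I'1: "\<one> \<notin> I'" using T(3) Tc by (auto simp: I'_def)
  let ?N = "carrier R - T"
  have add: "a \<oplus> b \<in> ?N" if ab: "a \<in> ?N" "b \<in> ?N" for a b
  proof (rule ccontr)
    assume "a \<oplus> b \<notin> ?N"
    then have c: "a \<oplus> b \<in> T" using ab by auto
    note [simp] = ab[THEN DiffD1]
    obtain n m :: nat where nm: "a [^] n \<in> I'" "b [^] m \<in> I'"
      using key[OF ab(1)] key[OF ab(2)] by (auto simp: I'_def)
    \<comment> \<open>Multiplying by \<open>a \<oplus> b \<in> T\<close> is injective modulo \<open>I'\<close>, which lets one lower the exponents
        of \<open>a\<close> and \<open>b\<close> one at a time; no binomial expansion is needed.\<close>
    have "\<forall>i j. i + j + k = n + m \<longrightarrow> a [^] i \<otimes> b [^] j \<in> I'" for k :: nat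
    proof (induct k)
      case 0
      show ?case
      proof (intro allI impI)
        fix i j assume "i + j + 0 = n + m"
        then have "n \<le> i \<or> m \<le> j" by linarith
        then consider d where "i = d + n" | d where "j = d + m"
          by (metis le_add_diff_inverse2)
        then show "a [^] i \<otimes> b [^] j \<in> I'"
        proof cases
          case 1
          then have "a [^] i \<otimes> b [^] j = (a [^] d \<otimes> b [^] j) \<otimes> a [^] n"
            by (simp add: nat_pow_mult[symmetric] m_ac)
          then show ?thesis using nm I' by (simp add: ideal.I_l_closed)
        next
          case 2
          then have "a [^] i \<otimes> b [^] j = (a [^] i \<otimes> b [^] d) \<otimes> b [^] m"
            by (simp add: nat_pow_mult[symmetric] m_ac)
          then show ?thesis using nm I' by (simp add: ideal.I_l_closed)
        qed
      qed
    next
      case (Suc k)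
      show ?case
      proof (intro allI impI)
        fix i j assume ij: "i + j + Suc k = n + m"
        have "(a \<oplus> b) \<otimes> (a [^] i \<otimes> b [^] j) = a \<otimes> (a [^] i \<otimes> b [^] j) \<oplus> b \<otimes> (a [^] i \<otimes> b [^] j)"
          by (simp add: l_distr)
        also have "\<dots> = a [^] Suc i \<otimes> b [^] j \<oplus> a [^] i \<otimes> b [^] Suc j"
          by (simp add: m_ac)
        also have "\<dots> \<in> I'"
          using Suc[rule_format, of "Suc i" j] Suc[rule_format, of i "Suc j"] ij I'
          by (simp add: additive_subgroup.a_closed ideal.axioms(1))
        finally show "a [^] i \<otimes> b [^] j \<in> I'"
          using I'T c by auto
      qed
    qed
    from this[of "n + m"] have "a [^] (0::nat) \<otimes> b [^] (0::nat) \<in> I'" by auto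
    then show False using I'1 by simp
  qed
  have mult: "x \<otimes> a \<in> ?N" if a: "a \<in> ?N" "x \<in> carrier R" for a x
  proof (rule ccontr)
    assume "x \<otimes> a \<notin> ?N"
    then have xa: "x \<otimes> a \<in> T" using a by auto
    obtain s n where s: "s \<in> T" "s \<otimes> a [^] (n::nat) \<in> I" using key[OF a(1)] by blast
    have "s \<otimes> (x \<otimes> a) [^] n = x [^] n \<otimes> (s \<otimes> a [^] n)"
      using a s Tc by (simp add: nat_pow_distrib m_ac)
    also have "\<dots> \<in> I" using a s I by (simp add: ideal.I_l_closed)
    finally show False using T(3) Tm[OF s(1) Tp[OF xa]] by blast
  qed
  have IN: "I \<subseteq> ?N" using T(3) I ideal.Icarr by fast
  have "\<zero> \<in> ?N" using IN additive_subgroup.zero_closed[OF ideal.axioms(1)[OF I]] by blast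
  then have "ideal ?N R"
    by (intro ideal_of_closed add mult) auto
  then have "primeideal ?N R"
    by (rule primeidealI[OF _ is_cring]) (use Tm T1 in auto)
  moreover have "?N \<inter> T\<^sub>0 = {}" using T(2) by auto
  moreover have "\<exists>s\<in>carrier R - ?N. \<exists>n::nat. s \<otimes> a [^] n \<in> I" if "a \<in> ?N" for a
    using key[OF that] Tc by blast
  ultimately show thesis using that IN by blast
qed

section \<open>Local rings\<close>

definition nonunits :: "('a, 'b) ring_scheme \<Rightarrow> 'a set" where
  "nonunits R = carrier R - Units R"

locale local_cring = cring +
  assumes nonunits_ideal: "ideal (nonunits R) R"

lemma (in cring) proper_ideal_nonunits:
  assumes "ideal I R" "I \<noteq> carrier R"
  shows "I \<subseteq> nonunits R"
proof
  fix u assume u: "u \<in> I"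
  have "u \<notin> Units R"
  proof
    assume "u \<in> Units R"
    then have "inv u \<otimes> u \<in> I" using ideal.I_l_closed[OF assms(1) u] by blast
    then show False
      using assms(2) \<open>u \<in> Units R\<close> ideal.one_imp_carrier[OF assms(1)] by simp
  qed
  then show "u \<in> nonunits R" using u assms(1) ideal.Icarr by (fastforce simp: nonunits_def)
qed

lemma (in cring) one_notin_nonunits: "\<one> \<notin> nonunits R"
  by (simp add: nonunits_def)

context local_cring
begin

lemma nonunits_carrier: "a \<in> nonunits R \<Longrightarrow> a \<in> carrier R"
  by (simp add: nonunits_def)

lemma nonunits_proper: "nonunits R \<noteq> carrier R"
  using one_notin_nonunits by auto

lemma one_minus_nonunit:
  assumes "m \<in> nonunits R"
  shows "\<one> \<ominus> m \<in> Units R"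
proof (rule ccontr)
  note m = nonunits_carrier[OF assms]
  assume "\<not> ?thesis"
  then have "\<one> \<ominus> m \<in> nonunits R" using m by (simp add: nonunits_def)
  then have "(\<one> \<ominus> m) \<oplus> m \<in> nonunits R"
    using assms nonunits_ideal by (simp add: additive_subgroup.a_closed ideal.axioms(1))
  moreover have "(\<one> \<ominus> m) \<oplus> m = \<one>" using m by algebra
  ultimately show False using one_notin_nonunits by simp
qed

text \<open>
  The form in which Nakayama-type arguments end: an equation \<open>x = k \<oplus> m \<otimes> x\<close> with \<open>k \<in> K\<close> and a
  nonunit \<open>m\<close> puts \<open>x\<close> into \<open>K\<close>.
\<close>
lemma unit_cancel_ideal:
  assumes "ideal K R" "m \<in> nonunits R" "x \<in> carrier R" "(\<one> \<ominus> m) \<otimes> x \<in> K"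
  shows "x \<in> K"
proof -
  have u: "\<one> \<ominus> m \<in> Units R" by (rule one_minus_nonunit[OF assms(2)])
  have "inv (\<one> \<ominus> m) \<otimes> ((\<one> \<ominus> m) \<otimes> x) \<in> K"
    using assms u by (simp add: ideal.I_l_closed)
  also have "inv (\<one> \<ominus> m) \<otimes> ((\<one> \<ominus> m) \<otimes> x) = x"
    using u assms(3) m_assoc[of "inv (\<one> \<ominus> m)" "\<one> \<ominus> m" x] Units_l_inv[OF u] Units_closed[OF u]
      Units_inv_closed[OF u] by simp
  finally show ?thesis .
qed

lemma nonunits_prime: "primeideal (nonunits R) R"
proof (rule primeidealI[OF nonunits_ideal is_cring])
  show "carrier R \<noteq> nonunits R" using nonunits_proper by simp
  fix a b assume "a \<in> carrier R" "b \<in> carrier R" "a \<otimes> b \<in> nonunits R"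
  then show "a \<in> nonunits R \<or> b \<in> nonunits R" by (auto simp: nonunits_def)
qed

lemma square_subset: "nonunits R \<cdot> nonunits R \<subseteq> nonunits R"
  using ideal_prod_inter[OF nonunits_ideal nonunits_ideal] by simp

lemma nonunits_radicalD:
  assumes "radical_ideal J R" "J \<noteq> carrier R" "\<And>a. a \<in> nonunits R \<Longrightarrow> \<exists>n::nat. a [^] n \<in> J"
  shows "J = nonunits R"
  using assms proper_ideal_nonunits[OF radical_ideal_is_ideal] radical_idealD[OF assms(1)] nonunits_carrier
  by blast

text \<open>
  Discard the factors equal to the whole ring. If at most one factor is left, the ideal is radical;
  otherwise two proper factors put it into the square of the maximal ideal.
\<close>
lemma SSP_radical_or_square:
  assumes "SSP_ring R" "ideal I R"
  shows "radical_ideal I R \<or> I \<subseteq> nonunits R \<cdot> nonunits R"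
proof -
  obtain Js where Js: "\<And>J. J \<in> set Js \<Longrightarrow> radical_ideal J R" "\<And>J. J \<in> set Js \<Longrightarrow> ideal J R"
    "I = ideal_product R Js"
    using SSP_ringE[OF assms] by metis
  have "radical_ideal (ideal_product R Js) R \<or> ideal_product R Js \<subseteq> nonunits R \<cdot> nonunits R"
    using Js(1,2)
  proof (induct Js)
    case Nil
    then show ?case by (simp add: radical_ideal_carrier)
  next
    case (Cons J Js)
    let ?X = "ideal_product R Js"
    have J: "ideal J R" "radical_ideal J R" and X: "ideal ?X R"
      using Cons by (auto intro: ideal_product_ideal)
    consider "J = carrier R" | "?X = carrier R" | "J \<subseteq> nonunits R" "?X \<subseteq> nonunits R"
      using J X proper_ideal_nonunits by blast
    then show ?case
    proof cases
      case 1
      then have "J \<cdot> ?X = ?X" using ideal_prod_one[OF X] ideal_prod_commute[OF J(1) X] by simp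
      then show ?thesis using Cons by simp
    next
      case 2
      then have "J \<cdot> ?X = J" using ideal_prod_one[OF J(1)] by simp
      then show ?thesis using J by simp
    next
      case 3
      then show ?thesis by (simp add: ideal_prod_mono)
    qed
  qed
  then show ?thesis using Js by simp
qed

lemma power_ideals_set_0: "nonunits R [^]\<^bsub>ideals_set R\<^esub> (0::nat) = carrier R"
  by (simp add: nat_pow_def ideals_set_def)

lemma power_ideals_set_Suc:
  "nonunits R [^]\<^bsub>ideals_set R\<^esub> Suc n = (nonunits R [^]\<^bsub>ideals_set R\<^esub> n) \<cdot> nonunits R"
  by (simp add: nat_pow_def ideals_set_def)

text \<open>
  The hypothesis says that the ideal has radical at least the maximal ideal, so each of its radical
  factors is the maximal ideal or the whole ring.
\<close>
lemma SSP_power_of_nonunits: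
  assumes "SSP_ring R" "ideal I R" "\<And>a. a \<in> nonunits R \<Longrightarrow> \<exists>n::nat. a [^] n \<in> I"
  obtains n :: nat where "I = nonunits R [^]\<^bsub>ideals_set R\<^esub> n"
proof -
  obtain Js where Js: "\<And>J. J \<in> set Js \<Longrightarrow> radical_ideal J R" "\<And>J. J \<in> set Js \<Longrightarrow> ideal J R"
    "\<And>J. J \<in> set Js \<Longrightarrow> I \<subseteq> J" "I = ideal_product R Js"
    using SSP_ringE[OF assms(1,2)] by metis
  have "J = nonunits R \<or> J = carrier R" if "J \<in> set Js" for J
    using nonunits_radicalD[of J] Js(1,3)[OF that] assms(3) by blast
  then have "\<exists>n::nat. ideal_product R Js = nonunits R [^]\<^bsub>ideals_set R\<^esub> n"
    using Js(2)
  proof (induct Js)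
    case Nil
    then show ?case by (metis foldr_Nil id_apply power_ideals_set_0)
  next
    case (Cons J Js)
    let ?X = "ideal_product R Js"
    obtain n :: nat where n: "?X = nonunits R [^]\<^bsub>ideals_set R\<^esub> n" using Cons by auto
    have J: "ideal J R" and X: "ideal ?X R"
      using Cons by (auto intro: ideal_product_ideal)
    have "J \<cdot> ?X = ?X \<cdot> J" by (rule ideal_prod_commute[OF J X])
    moreover have "J = nonunits R \<or> J = carrier R" using Cons by simp
    ultimately have "J \<cdot> ?X = ?X \<cdot> nonunits R \<or> J \<cdot> ?X = ?X" using ideal_prod_one[OF X] by auto
    then show ?case using n power_ideals_set_Suc by (metis comp_apply foldr_Cons)
  qed
  then show thesis using that Js(4) by blast
qed

lemma SSP_idempotent_nonunits:
  assumes "SSP_ring R" "ideal I R" "I \<noteq> carrier R" "\<And>a. a \<in> nonunits R \<Longrightarrow> \<exists>n::nat. a [^] n \<in> I"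
    and idem: "nonunits R \<cdot> nonunits R = nonunits R"
  shows "I = nonunits R"
proof -
  obtain n :: nat where n: "I = nonunits R [^]\<^bsub>ideals_set R\<^esub> n"
    using SSP_power_of_nonunits[OF assms(1,2,4)] by metis
  have "nonunits R [^]\<^bsub>ideals_set R\<^esub> Suc k = nonunits R" for k
  proof (induct k)
    case 0
    show ?case
      using ideal_prod_one[OF nonunits_ideal] ideal_prod_commute[OF nonunits_ideal oneideal]
      by (simp only: power_ideals_set_Suc power_ideals_set_0)
  next
    case (Suc k)
    then show ?case using idem by (simp only: power_ideals_set_Suc)
  qed
  then show ?thesis using n assms(3) power_ideals_set_0 by (metis not0_implies_Suc)
qed

lemma SSP_eq_nonunits:
  assumes "SSP_ring R" "ideal I R" "I \<noteq> carrier R" "\<And>a. a \<in> nonunits R \<Longrightarrow> \<exists>n::nat. a [^] n \<in> I"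
    and "\<not> I \<subseteq> nonunits R \<cdot> nonunits R"
  shows "I = nonunits R"
  using SSP_radical_or_square[OF assms(1,2)] assms nonunits_radicalD by blast

end

lemma (in cring) mem_prod_PIdl:
  assumes "ideal I R" "f \<in> carrier R" "x \<in> I \<cdot> (PIdl f)"
  obtains i where "i \<in> I" "x = i \<otimes> f"
proof -
  have "\<exists>i\<in>I. x = i \<otimes> f"
    using assms(3)
  proof induct
    case (prod i j)
    then obtain r where r: "r \<in> carrier R" "j = r \<otimes> f" by (auto simp: mem_PIdl)
    then have "i \<otimes> j = (i \<otimes> r) \<otimes> f" "i \<otimes> r \<in> I"
      using assms(1,2) prod(1) by (auto simp: m_assoc ideal.Icarr ideal.I_r_closed)
    then show ?case by blast
  next
    case (sum s t)
    then obtain i j where "i \<in> I" "j \<in> I" "s = i \<otimes> f" "t = j \<otimes> f" by blast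
    then have "s \<oplus> t = (i \<oplus> j) \<otimes> f" "i \<oplus> j \<in> I"
      using assms(1,2)
      by (simp_all add: l_distr ideal.Icarr additive_subgroup.a_closed ideal.axioms(1))
    then show ?case by blast
  qed
  then show thesis using that by blast
qed

context local_cring
begin

text \<open>
  Nakayama's lemma for the module \<open>I / K\<close> generated by the classes of the elements of \<open>F\<close>. In the
  induction one generator is moved from \<open>F\<close> into \<open>K\<close>; the enlarged \<open>K\<close> then contains \<open>I\<close>, and the
  generator is expressed by \<open>K\<close> and a nonunit multiple of itself.
\<close>
lemma nakayama:
  assumes "finite F" "F \<subseteq> carrier R" "ideal K R" "ideal I R"
    and "I = Idl (K \<union> F)" "I \<subseteq> K <+> (nonunits R \<cdot> I)"
  shows "I \<subseteq> K"
  using assms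
proof (induct F arbitrary: K)
  case empty
  then show ?case using genideal_minimal[of K K] by simp
next
  case (insert f F)
  let ?K = "K <+> PIdl f" and ?M = "nonunits R"
  have f: "f \<in> carrier R" "ideal (PIdl f) R" "f \<in> PIdl f"
    using insert cgenideal_ideal cgenideal_self by auto
  have K: "ideal ?K R" "K \<subseteq> ?K" "PIdl f \<subseteq> ?K"
    using f insert add_ideals subset_set_add[of K "PIdl f"] by auto
  have "K \<union> insert f F \<subseteq> carrier R" using insert(4) ideal_carrier[OF insert(5)] by blast
  then have KI: "K \<union> insert f F \<subseteq> I"
    unfolding insert(7) by (rule genideal_self)
  have KI': "?K \<subseteq> I"
    using KI insert f by (intro set_add_subset cgenideal_minimal) auto
  have "I = Idl (?K \<union> F)"
  proof
    show "Idl (?K \<union> F) \<subseteq> I" using KI KI' insert by (intro genideal_minimal) auto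
    have c: "?K \<union> F \<subseteq> carrier R" using insert(4) ideal_carrier[OF K(1)] by blast
    have "K \<union> insert f F \<subseteq> Idl (?K \<union> F)" using K f genideal_self[OF c] by blast
    then show "I \<subseteq> Idl (?K \<union> F)"
      unfolding insert(7) using c by (intro genideal_minimal genideal_ideal)
  qed
  moreover have "I \<subseteq> ?K <+> (?M \<cdot> I)"
    using insert(8) set_add_mono[OF K(2) order_refl[of "?M \<cdot> I"], of R] by (rule order_trans)
  ultimately have IK: "I \<subseteq> ?K" using insert K by simp
  have "?M \<cdot> I \<subseteq> ?M \<cdot> ?K" by (intro ideal_prod_mono IK order_refl)
  moreover have "f \<in> K <+> (?M \<cdot> I)" using insert(8) KI by blast
  ultimately have "f \<in> K <+> (?M \<cdot> ?K)" using set_add_mono[OF order_refl[of K], of "?M \<cdot> I" "?M \<cdot> ?K" R] by blast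
  then obtain k w where kw: "k \<in> K" "w \<in> ?M \<cdot> ?K" "f = k \<oplus> w" by (auto simp: mem_set_add)
  then obtain w1 w2 where w: "w1 \<in> ?M \<cdot> K" "w2 \<in> ?M \<cdot> (PIdl f)" "w = w1 \<oplus> w2"
    using ideal_prod_r_distr[OF nonunits_ideal insert(5) f(2)] by (auto simp: mem_set_add)
  obtain m where m: "m \<in> ?M" "w2 = m \<otimes> f"
    using mem_prod_PIdl[OF nonunits_ideal f(1) w(2)] by blast
  have w1: "w1 \<in> K" using ideal_prod_inter[OF nonunits_ideal insert(5)] w by auto
  note [simp] = f(1) nonunits_carrier[OF m(1)] ideal.Icarr[OF insert(5) kw(1)] ideal.Icarr[OF insert(5) w1]
  have "(\<one> \<ominus> m) \<otimes> f = f \<ominus> m \<otimes> f" by (simp add: a_minus_def l_distr l_minus)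
  also have "\<dots> = k \<oplus> (w1 \<oplus> m \<otimes> f) \<ominus> m \<otimes> f"
    by (rule arg_cong[OF kw(3)[unfolded w(3) m(2)]])
  also have "\<dots> = k \<oplus> w1" by (simp add: a_minus_def a_assoc r_neg)
  finally have "(\<one> \<ominus> m) \<otimes> f \<in> K"
    using kw w1 insert(5) by (simp add: additive_subgroup.a_closed ideal.axioms(1))
  then have "f \<in> K" using unit_cancel_ideal insert(5) m by simp
  then have "?K \<subseteq> K" using insert(5) by (intro set_add_subset cgenideal_minimal) auto
  then show ?case using IK by blast
qed

text \<open>
  The maximal ideal \<open>M\<close> is the radical of the finitely generated ideal \<open>I = Idl F\<close>. If \<open>M\<close> is
  idempotent, it equals \<open>I\<close> and Nakayama's lemma makes it zero. Otherwise any nonunit \<open>z\<close>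
  outside its square satisfies \<open>M = (z) + I = (z) + I\<^sup>2\<close>, and Nakayama's lemma gives \<open>M = (z)\<close>.
\<close>
lemma SSP_nonunits_principal:
  assumes SSP: "SSP_ring R" and F: "finite F" "F \<subseteq> carrier R" "Idl F \<noteq> carrier R"
    and nil: "\<And>a. a \<in> nonunits R \<Longrightarrow> \<exists>n::nat. a [^] n \<in> Idl F"
  obtains z where "z \<in> nonunits R" "nonunits R = PIdl z"
proof (cases "nonunits R \<cdot> nonunits R = nonunits R")
  case True
  let ?M = "nonunits R"
  have I: "ideal (Idl F) R" using F genideal_ideal by blast
  have M: "Idl F = ?M" by (rule SSP_idempotent_nonunits[OF SSP I F(3) nil True])
  have z0: "{\<zero>} \<union> F \<subseteq> carrier R" "\<zero> \<in> ?M"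
    using F nonunits_ideal by (auto simp: additive_subgroup.zero_closed ideal.axioms(1))
  have "?M = Idl ({\<zero>} \<union> F)"
  proof
    show "?M \<subseteq> Idl ({\<zero>} \<union> F)"
      unfolding M[symmetric] using z0 by (intro subset_Idl_subset) auto
    show "Idl ({\<zero>} \<union> F) \<subseteq> ?M"
      using z0 M genideal_self[OF F(2)] by (intro genideal_minimal nonunits_ideal) auto
  qed
  moreover have "?M \<subseteq> {\<zero>} <+> (?M \<cdot> ?M)"
    using True nonunits_carrier by (auto simp: mem_set_add)
  ultimately have "?M \<subseteq> {\<zero>}"
    using nakayama[OF F(1,2) zeroideal nonunits_ideal] by blast
  then have "?M = PIdl \<zero>"
    using cgenideal_self[of \<zero>] cgenideal_minimal[OF nonunits_ideal z0(2)] by auto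
  then show ?thesis using that z0 by blast
next
  case False
  let ?M = "nonunits R"
  have I: "ideal (Idl F) R" using F genideal_ideal by blast
  have IM: "Idl F \<subseteq> ?M" using proper_ideal_nonunits[OF I F(3)] .
  obtain z where z: "z \<in> ?M" "z \<notin> ?M \<cdot> ?M" using False square_subset by blast
  have zc: "z \<in> carrier R" and Z: "ideal (PIdl z) R" "z \<in> PIdl z" "PIdl z \<subseteq> ?M"
    using z nonunits_carrier cgenideal_ideal cgenideal_self cgenideal_minimal[OF nonunits_ideal] by auto
  \<comment> \<open>An ideal containing \<open>z\<close> is not contained in the square, hence radical if it is proper.\<close>
  have eq: "PIdl z <+> K = ?M"
    if K: "ideal K R" "K \<subseteq> ?M" "\<And>a. a \<in> ?M \<Longrightarrow> \<exists>n::nat. a [^] n \<in> K" for K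
  proof (rule SSP_eq_nonunits[OF SSP])
    show "ideal (PIdl z <+> K) R" using K Z add_ideals by blast
    have "PIdl z <+> K \<subseteq> ?M" using K Z nonunits_ideal by (intro set_add_subset)
    then show "PIdl z <+> K \<noteq> carrier R" using one_notin_nonunits by auto
    show "\<exists>n::nat. a [^] n \<in> PIdl z <+> K" if "a \<in> ?M" for a
      using K(3)[OF that] subset_set_add[OF Z(1) K(1)] by blast
    show "\<not> PIdl z <+> K \<subseteq> ?M \<cdot> ?M"
      using z Z subset_set_add[OF Z(1) K(1)] by blast
  qed
  have 1: "PIdl z <+> Idl F = ?M" by (rule eq[OF I IM nil])
  have "?M = Idl (PIdl z \<union> F)"
  proof
    have c: "PIdl z \<union> F \<subseteq> carrier R" using F Z nonunits_carrier by blast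
    have "PIdl z <+> Idl F \<subseteq> Idl (PIdl z \<union> F)"
      using c genideal_self[OF c] by (intro set_add_subset genideal_ideal genideal_minimal) auto
    then show "?M \<subseteq> Idl (PIdl z \<union> F)" using 1 by simp
    show "Idl (PIdl z \<union> F) \<subseteq> ?M"
      using Z IM genideal_self[OF F(2)] by (intro genideal_minimal nonunits_ideal) auto
  qed
  moreover have "?M \<subseteq> PIdl z <+> (?M \<cdot> ?M)"
  proof -
    have "\<exists>n::nat. a [^] n \<in> (Idl F) \<cdot> (Idl F)" if "a \<in> ?M" for a
    proof -
      obtain n :: nat where n: "a [^] n \<in> Idl F" using nil \<open>a \<in> ?M\<close> by blast
      have "a [^] (n + n) = a [^] n \<otimes> a [^] n"
        using \<open>a \<in> ?M\<close> nonunits_carrier by (simp add: nat_pow_mult)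
      then show ?thesis using n ideal_prod.prod by metis
    qed
    then have "PIdl z <+> ((Idl F) \<cdot> (Idl F)) = ?M"
      using ideal_prod_inter[OF I I] IM by (intro eq ideal_prod_is_ideal I) auto
    moreover have "(Idl F) \<cdot> (Idl F) \<subseteq> ?M \<cdot> ?M" by (intro ideal_prod_mono IM)
    ultimately show ?thesis
      using set_add_mono[OF order_refl[of "PIdl z"], of "(Idl F) \<cdot> (Idl F)" "?M \<cdot> ?M" R] by simp
  qed
  ultimately have "?M \<subseteq> PIdl z" using nakayama[OF F(1,2) Z(1) nonunits_ideal] by blast
  then show ?thesis using that z Z by blast
qed

text \<open>
  From \<open>x = c z\<^sup>2\<close> the element \<open>c z\<close> has its square in \<open>(x)\<close>, so \<open>c z\<close> is a multiple of
  \<open>x = (c z) z\<close>, that is, a nonunit multiple of itself.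
\<close>
lemma radical_generator_in_square:
  assumes z: "z \<in> nonunits R" "nonunits R = PIdl z"
    and x: "x \<in> nonunits R \<cdot> nonunits R" "radical_ideal (PIdl x) R"
  shows "x = \<zero>"
proof -
  have zc [simp]: "z \<in> carrier R" using z nonunits_carrier by blast
  obtain m where m: "m \<in> nonunits R" "x = m \<otimes> z"
    using x(1) z(2) mem_prod_PIdl[OF nonunits_ideal zc] by metis
  obtain c where c [simp]: "c \<in> carrier R" and mc: "m = c \<otimes> z" using m(1) z(2) by (auto simp: mem_PIdl)
  have xc [simp]: "x \<in> carrier R" using m mc by simp
  have "(c \<otimes> z) [^] (2::nat) = c \<otimes> x"
    unfolding m mc by (simp add: numeral_2_eq_2 m_ac)
  also have "\<dots> \<in> PIdl x" using mem_PIdl by auto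
  finally have "c \<otimes> z \<in> PIdl x" using radical_idealD[OF x(2)] by simp
  then obtain d where d [simp]: "d \<in> carrier R" and dx: "c \<otimes> z = d \<otimes> x" by (auto simp: mem_PIdl)
  have dz: "d \<otimes> z \<in> nonunits R" using z(1) nonunits_ideal by (simp add: ideal.I_l_closed)
  have "(\<one> \<ominus> d \<otimes> z) \<otimes> (c \<otimes> z) = c \<otimes> z \<ominus> d \<otimes> (c \<otimes> z \<otimes> z)"
    using c d zc by algebra
  also have "c \<otimes> z \<otimes> z = x" using m(2) mc by simp
  also have "c \<otimes> z \<ominus> d \<otimes> x = \<zero>" by (simp add: dx a_minus_def r_neg)
  finally have "c \<otimes> z = \<zero>" using unit_cancel_ideal[OF zeroideal dz] by simp
  then show ?thesis using m mc by simp
qed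

text \<open>
  The ideal \<open>P + (y\<^sup>2)\<close> has the same radical as \<open>P + (y)\<close>, namely the maximal ideal, but it does not contain
  \<open>y\<close>: otherwise \<open>(1 - r y) y \<in> P\<close> for some \<open>r\<close>. Being different from the maximal ideal, it lies in the
  square of that ideal. If the maximal ideal were idempotent, the two would be equal.
\<close>
lemma SSP_prime_subset_square:
  assumes SSP: "SSP_ring R" and P: "primeideal P R" and y: "y \<in> nonunits R" "y \<notin> P"
    and nil: "\<And>a. a \<in> nonunits R \<Longrightarrow> \<exists>n::nat. a [^] n \<in> P <+> PIdl y"
  shows "P \<subseteq> nonunits R \<cdot> nonunits R" "nonunits R \<cdot> nonunits R \<noteq> nonunits R"
proof -
  let ?M = "nonunits R" and ?I = "P <+> PIdl (y \<otimes> y)"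
  have [simp]: "y \<in> carrier R" using y nonunits_carrier by blast
  note Pi = primeideal.axioms(1)[OF P]
  have PM: "P \<subseteq> ?M"
    using proper_ideal_nonunits[OF Pi] primeideal.I_notcarr[OF P] by blast
  have Yi: "ideal (PIdl (y \<otimes> y)) R" by (simp add: cgenideal_ideal)
  have I: "ideal ?I R" using Pi Yi add_ideals by blast
  have "y \<otimes> y \<in> ?M" using y nonunits_ideal by (simp add: ideal.I_l_closed)
  then have IM: "?I \<subseteq> ?M" using PM by (intro set_add_subset cgenideal_minimal nonunits_ideal)
  then have Ic: "?I \<noteq> carrier R" using one_notin_nonunits by auto
  have nil2: "\<exists>n::nat. a [^] n \<in> ?I" if a: "a \<in> ?M" for a
  proof -
    obtain n p r where n: "a [^] (n::nat) = p \<oplus> r \<otimes> y" "p \<in> P" "r \<in> carrier R"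
      using nil[OF a] by (auto simp: mem_set_add mem_PIdl)
    have [simp]: "p \<in> carrier R" "r \<in> carrier R" using n Pi ideal.Icarr by auto
    have "a [^] (n + n) = (p \<oplus> r \<otimes> y) \<otimes> (p \<oplus> r \<otimes> y)"
      using n a nonunits_carrier by (simp add: nat_pow_mult[symmetric])
    also have "\<dots> = (p \<oplus> r \<otimes> y \<oplus> r \<otimes> y) \<otimes> p \<oplus> (r \<otimes> r) \<otimes> (y \<otimes> y)"
      using \<open>r \<in> carrier R\<close> \<open>y \<in> carrier R\<close> \<open>p \<in> carrier R\<close> by algebra
    finally have "a [^] (n + n) = (p \<oplus> r \<otimes> y \<oplus> r \<otimes> y) \<otimes> p \<oplus> (r \<otimes> r) \<otimes> (y \<otimes> y)" .
    moreover have "(p \<oplus> r \<otimes> y \<oplus> r \<otimes> y) \<otimes> p \<in> P" using n Pi by (simp add: ideal.I_l_closed)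
    moreover have "(r \<otimes> r) \<otimes> (y \<otimes> y) \<in> PIdl (y \<otimes> y)" by (auto simp: mem_PIdl)
    ultimately show ?thesis by (metis mem_set_add)
  qed
  have yI: "y \<notin> ?I"
  proof
    assume "y \<in> ?I"
    then obtain p r where p: "p \<in> P" "r \<in> carrier R" "y = p \<oplus> r \<otimes> (y \<otimes> y)"
      by (auto simp: mem_set_add mem_PIdl)
    have [simp]: "p \<in> carrier R" "r \<in> carrier R" using p Pi ideal.Icarr by auto
    have "(\<one> \<ominus> r \<otimes> y) \<otimes> y = y \<ominus> r \<otimes> (y \<otimes> y)"
      using \<open>r \<in> carrier R\<close> \<open>y \<in> carrier R\<close> by algebra
    also have "\<dots> = (p \<oplus> r \<otimes> (y \<otimes> y)) \<ominus> r \<otimes> (y \<otimes> y)"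
      by (rule arg_cong[OF p(3)])
    also have "\<dots> = p" by (simp add: a_minus_def a_assoc r_neg)
    finally have "(\<one> \<ominus> r \<otimes> y) \<otimes> y \<in> P" using p by simp
    moreover have "r \<otimes> y \<in> ?M" using y nonunits_ideal by (simp add: ideal.I_l_closed)
    ultimately show False using unit_cancel_ideal[OF Pi, of "r \<otimes> y" y] y(2) by auto
  qed
  have "?I \<subseteq> ?M \<cdot> ?M" using SSP_eq_nonunits[OF SSP I Ic nil2] yI y by blast
  then show "P \<subseteq> ?M \<cdot> ?M" using subset_set_add(1)[OF Pi Yi] by blast
  show "?M \<cdot> ?M \<noteq> ?M" using SSP_idempotent_nonunits[OF SSP I Ic nil2] yI y by blast
qed

end

section \<open>Localizations and quotients\<close>

text \<open>
  A ring homomorphism for which every element of the target is a fraction \<open>h a / h t\<close> with \<open>t \<in> T\<close>.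
  Localizations and quotients (with \<open>T = {1}\<close>) are both of this kind, and the behaviour of
  ideals under extension is the same for both.
\<close>
locale fraction_hom = ring_hom_cring R S h
  for R (structure) and S (structure) and h +
  fixes T
  assumes T: "submonoid T R"
    and hom_Units: "t \<in> T \<Longrightarrow> h t \<in> Units S"
    and fraction: "y \<in> carrier S \<Longrightarrow> \<exists>a\<in>carrier R. \<exists>t\<in>T. h t \<otimes>\<^bsub>S\<^esub> y = h a"
begin

lemma T_carrier: "t \<in> T \<Longrightarrow> t \<in> carrier R"
  using submonoid.subset[OF T] by blast

lemmas T_mult = submonoid.m_closed[OF T] and T_one = submonoid.one_closed[OF T]

lemma hom_unit_cancel:
  assumes "ideal I S" "t \<in> T" "y \<in> carrier S" "h t \<otimes>\<^bsub>S\<^esub> y \<in> I"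
  shows "y \<in> I"
proof -
  have u: "h t \<in> Units S" using assms hom_Units by blast
  have "inv\<^bsub>S\<^esub> (h t) \<otimes>\<^bsub>S\<^esub> (h t \<otimes>\<^bsub>S\<^esub> y) \<in> I"
    using assms u by (simp add: ideal.I_l_closed)
  also have "inv\<^bsub>S\<^esub> (h t) \<otimes>\<^bsub>S\<^esub> (h t \<otimes>\<^bsub>S\<^esub> y) = y"
    using S.m_assoc[of "inv\<^bsub>S\<^esub> (h t)" "h t" y] u assms(3) S.Units_l_inv[OF u] S.Units_closed[OF u]
      S.Units_inv_closed[OF u] by simp
  finally show ?thesis .
qed

definition extension :: "'a set \<Rightarrow> 'c set" where
  "extension J = {y \<in> carrier S. \<exists>t\<in>T. \<exists>j\<in>J. h t \<otimes>\<^bsub>S\<^esub> y = h j}"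

lemma mem_extensionI:
  "\<lbrakk>t \<in> T; h t \<otimes>\<^bsub>S\<^esub> y = h j; j \<in> J; y \<in> carrier S\<rbrakk> \<Longrightarrow> y \<in> extension J"
  unfolding extension_def by blast

lemma extension_ideal:
  assumes "ideal J R"
  shows "ideal (extension J) S"
proof (rule S.ideal_of_closed)
  have J0: "\<zero> \<in> J" and Jadd: "\<And>i j. i \<in> J \<Longrightarrow> j \<in> J \<Longrightarrow> i \<oplus> j \<in> J"
    and Jc: "\<And>j. j \<in> J \<Longrightarrow> j \<in> carrier R"
    using assms by (auto simp: additive_subgroup.zero_closed additive_subgroup.a_closed ideal.axioms(1) ideal.Icarr)
  show "extension J \<subseteq> carrier S" by (auto simp: extension_def)
  have "h \<one> \<otimes>\<^bsub>S\<^esub> \<zero>\<^bsub>S\<^esub> = h \<zero>" by simp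
  then show "\<zero>\<^bsub>S\<^esub> \<in> extension J"
    unfolding extension_def using T_one J0 by blast
  fix x y assume x: "x \<in> extension J"
  then obtain s i where s: "s \<in> T" "i \<in> J" "h s \<otimes>\<^bsub>S\<^esub> x = h i" "x \<in> carrier S"
    by (auto simp: extension_def)
  note [simp] = T_carrier[OF s(1)] Jc[OF s(2)] s(4)
  {
    assume "y \<in> extension J"
    then obtain t j where t: "t \<in> T" "j \<in> J" "h t \<otimes>\<^bsub>S\<^esub> y = h j" "y \<in> carrier S"
      by (auto simp: extension_def)
    note [simp] = T_carrier[OF t(1)] Jc[OF t(2)] t(4)
    have "h (s \<otimes> t) \<otimes>\<^bsub>S\<^esub> (x \<oplus>\<^bsub>S\<^esub> y) = h t \<otimes>\<^bsub>S\<^esub> (h s \<otimes>\<^bsub>S\<^esub> x) \<oplus>\<^bsub>S\<^esub> h s \<otimes>\<^bsub>S\<^esub> (h t \<otimes>\<^bsub>S\<^esub> y)"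
      by (simp add: S.r_distr S.m_ac)
    also have "\<dots> = h (t \<otimes> i \<oplus> s \<otimes> j)" by (simp add: s t)
    finally have "h (s \<otimes> t) \<otimes>\<^bsub>S\<^esub> (x \<oplus>\<^bsub>S\<^esub> y) = h (t \<otimes> i \<oplus> s \<otimes> j)" .
    moreover have "t \<otimes> i \<oplus> s \<otimes> j \<in> J" using s t assms Jadd by (simp add: ideal.I_l_closed)
    ultimately show "x \<oplus>\<^bsub>S\<^esub> y \<in> extension J"
      by (rule mem_extensionI[OF T_mult[OF s(1) t(1)]]) simp
  next
    assume y: "y \<in> carrier S"
    then obtain a t where t: "a \<in> carrier R" "t \<in> T" "h t \<otimes>\<^bsub>S\<^esub> y = h a" using fraction by blast
    note [simp] = T_carrier[OF t(2)] t(1) y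
    have "h (s \<otimes> t) \<otimes>\<^bsub>S\<^esub> (y \<otimes>\<^bsub>S\<^esub> x) = (h t \<otimes>\<^bsub>S\<^esub> y) \<otimes>\<^bsub>S\<^esub> (h s \<otimes>\<^bsub>S\<^esub> x)"
      by (simp add: S.m_ac)
    also have "\<dots> = h (a \<otimes> i)" by (simp add: s t)
    finally have "h (s \<otimes> t) \<otimes>\<^bsub>S\<^esub> (y \<otimes>\<^bsub>S\<^esub> x) = h (a \<otimes> i)" .
    moreover have "a \<otimes> i \<in> J" using s t assms by (simp add: ideal.I_l_closed)
    ultimately show "y \<otimes>\<^bsub>S\<^esub> x \<in> extension J"
      by (rule mem_extensionI[OF T_mult[OF s(1) t(2)]]) simp
  }
qed

lemma hom_mem_extension:
  assumes "j \<in> J" "j \<in> carrier R"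
  shows "h j \<in> extension J"
proof -
  have "h \<one> \<otimes>\<^bsub>S\<^esub> h j = h j" using assms by simp
  then show ?thesis unfolding extension_def using assms T_one by blast
qed

lemma extension_least:
  assumes "ideal I S" "\<And>j. j \<in> J \<Longrightarrow> h j \<in> I"
  shows "extension J \<subseteq> I"
proof
  fix y assume "y \<in> extension J"
  then obtain t j where t: "t \<in> T" "j \<in> J" "h t \<otimes>\<^bsub>S\<^esub> y = h j" "y \<in> carrier S"
    by (auto simp: extension_def)
  then have "h t \<otimes>\<^bsub>S\<^esub> y \<in> I" using assms(2) by simp
  then show "y \<in> I" using hom_unit_cancel[OF assms(1) t(1,4)] by simp
qed

lemma extension_contraction:
  assumes "ideal I S"
  shows "extension {a \<in> carrier R. h a \<in> I} = I"
proof
  show "extension {a \<in> carrier R. h a \<in> I} \<subseteq> I" by (rule extension_least[OF assms]) simp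
  show "I \<subseteq> extension {a \<in> carrier R. h a \<in> I}"
  proof
    fix y assume y: "y \<in> I"
    then have yc: "y \<in> carrier S" using assms ideal.Icarr by fast
    then obtain a t where t: "a \<in> carrier R" "t \<in> T" "h t \<otimes>\<^bsub>S\<^esub> y = h a" using fraction by blast
    have "h t \<otimes>\<^bsub>S\<^esub> y \<in> I" using ideal.I_l_closed[OF assms y, of "h t"] T_carrier[OF t(2)] by simp
    then show "y \<in> extension {a \<in> carrier R. h a \<in> I}"
      unfolding extension_def using t yc by auto
  qed
qed

lemma extension_carrier: "extension (carrier R) = carrier S"
  using fraction unfolding extension_def by blast

lemma extension_prod:
  assumes J: "ideal J R" and K: "ideal K R"
  shows "extension (J \<cdot> K) = extension J \<cdot>\<^bsub>S\<^esub> extension K"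
proof
  note I = S.ideal_prod_is_ideal[OF extension_ideal[OF J] extension_ideal[OF K]]
  have c: "x \<in> carrier R" if "x \<in> J \<cdot> K" for x
    using that R.ideal_prod_in_carrier[OF J K] by blast
  show "extension (J \<cdot> K) \<subseteq> extension J \<cdot>\<^bsub>S\<^esub> extension K"
  proof (rule extension_least[OF I])
    fix x assume "x \<in> J \<cdot> K"
    then show "h x \<in> extension J \<cdot>\<^bsub>S\<^esub> extension K"
    proof induct
      case (prod i j)
      then have "i \<in> carrier R" "j \<in> carrier R" using J K ideal.Icarr by fast+
      then show ?case using prod hom_mem_extension by (simp add: ideal_prod.prod)
    next
      case (sum x y)
      then show ?case using c by (simp add: ideal_prod.sum)
    qed
  qed
  show "extension J \<cdot>\<^bsub>S\<^esub> extension K \<subseteq> extension (J \<cdot> K)"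
  proof (rule S.ideal_prod_subset_ideal[OF extension_ideal[OF R.ideal_prod_is_ideal[OF J K]]])
    fix x y assume "x \<in> extension J" "y \<in> extension K"
    then obtain s i t j where s: "s \<in> T" "i \<in> J" "h s \<otimes>\<^bsub>S\<^esub> x = h i" "x \<in> carrier S"
      and t: "t \<in> T" "j \<in> K" "h t \<otimes>\<^bsub>S\<^esub> y = h j" "y \<in> carrier S"
      by (auto simp: extension_def)
    have [simp]: "s \<in> carrier R" "t \<in> carrier R" "i \<in> carrier R" "j \<in> carrier R"
      using s t T_carrier J K ideal.Icarr by fast+
    have "h (s \<otimes> t) \<otimes>\<^bsub>S\<^esub> (x \<otimes>\<^bsub>S\<^esub> y) = (h s \<otimes>\<^bsub>S\<^esub> x) \<otimes>\<^bsub>S\<^esub> (h t \<otimes>\<^bsub>S\<^esub> y)"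
      using s(4) t(4) by (simp add: S.m_ac)
    also have "\<dots> = h (i \<otimes> j)" by (simp add: s t)
    finally have "h (s \<otimes> t) \<otimes>\<^bsub>S\<^esub> (x \<otimes>\<^bsub>S\<^esub> y) = h (i \<otimes> j)" .
    then show "x \<otimes>\<^bsub>S\<^esub> y \<in> extension (J \<cdot> K)"
      by (rule mem_extensionI[OF T_mult[OF s(1) t(1)]]) (use s t in \<open>simp_all add: ideal_prod.prod\<close>)
  qed
qed

lemma extension_product:
  assumes "\<And>J. J \<in> set Js \<Longrightarrow> ideal J R"
  shows "extension (ideal_product R Js) = ideal_product S (map extension Js)"
  using assms
proof (induct Js)
  case Nil
  show ?case by (simp add: extension_carrier)
next
  case (Cons J Js)
  then show ?case by (simp add: extension_prod R.ideal_product_ideal)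
qed

text \<open>
  An equation \<open>h t \<otimes> h a = h j\<close> lifts to \<open>R\<close> only up to the kernel, so \<open>J\<close> has to contain it. Ideals with this
  property are those that contain the contraction of an ideal of \<open>S\<close>, in particular the factors of such a
  contraction, and, for a localization, all primes disjoint from \<open>T\<close>.
\<close>
lemma hom_mem_extension_iff:
  assumes J: "ideal J R" and ker: "\<And>a. a \<in> carrier R \<Longrightarrow> h a = \<zero>\<^bsub>S\<^esub> \<Longrightarrow> a \<in> J"
    and a: "a \<in> carrier R"
  shows "h a \<in> extension J \<longleftrightarrow> (\<exists>t\<in>T. t \<otimes> a \<in> J)"
proof
  assume "h a \<in> extension J"
  then obtain t j where t: "t \<in> T" "j \<in> J" "h t \<otimes>\<^bsub>S\<^esub> h a = h j" by (auto simp: extension_def)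
  have [simp]: "t \<in> carrier R" "j \<in> carrier R" using t T_carrier J ideal.Icarr by fast+
  have "h (t \<otimes> a \<ominus> j) = h t \<otimes>\<^bsub>S\<^esub> h a \<ominus>\<^bsub>S\<^esub> h j"
    using a by (simp add: a_minus_def)
  also have "\<dots> = \<zero>\<^bsub>S\<^esub>" using t(3) by (simp add: a_minus_def S.r_neg)
  finally have "t \<otimes> a \<ominus> j \<in> J" using ker a by simp
  then have "(t \<otimes> a \<ominus> j) \<oplus> j \<in> J" using t(2) J by (simp add: additive_subgroup.a_closed ideal.axioms(1))
  moreover have "(t \<otimes> a \<ominus> j) \<oplus> j = t \<otimes> a" using a by (simp add: a_minus_def R.a_assoc R.l_neg)
  ultimately show "\<exists>t\<in>T. t \<otimes> a \<in> J" using t(1) by auto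
next
  assume "\<exists>t\<in>T. t \<otimes> a \<in> J"
  then obtain t where t: "t \<in> T" "t \<otimes> a \<in> J" by blast
  have [simp]: "t \<in> carrier R" using t T_carrier by blast
  have "h t \<otimes>\<^bsub>S\<^esub> h a \<in> extension J" using hom_mem_extension[OF t(2)] a by simp
  then show "h a \<in> extension J"
    using hom_unit_cancel[OF extension_ideal[OF J] t(1)] a by simp
qed

lemma extension_radical:
  assumes J: "radical_ideal J R" and ker: "\<And>a. a \<in> carrier R \<Longrightarrow> h a = \<zero>\<^bsub>S\<^esub> \<Longrightarrow> a \<in> J"
  shows "radical_ideal (extension J) S"
proof (rule S.radical_idealI)
  note Ji = radical_ideal_is_ideal[OF J]
  note E = extension_ideal[OF Ji]
  show "ideal (extension J) S" by (rule E)
  fix y and n :: nat assume y: "y \<in> carrier S" "y [^]\<^bsub>S\<^esub> n \<in> extension J"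
  then obtain a t where t: "a \<in> carrier R" "t \<in> T" "h t \<otimes>\<^bsub>S\<^esub> y = h a" using fraction by blast
  have [simp]: "t \<in> carrier R" using t T_carrier by blast
  have "h (a [^] n) = (h t \<otimes>\<^bsub>S\<^esub> y) [^]\<^bsub>S\<^esub> n" using t by (simp add: ring.hom_nat_pow)
  also have "\<dots> = h t [^]\<^bsub>S\<^esub> n \<otimes>\<^bsub>S\<^esub> y [^]\<^bsub>S\<^esub> n" using y by (simp add: S.nat_pow_distrib)
  also have "\<dots> \<in> extension J" using y E by (simp add: ideal.I_l_closed)
  finally obtain s where s: "s \<in> T" "s \<otimes> a [^] n \<in> J"
    using hom_mem_extension_iff[OF Ji ker, of "a [^] n"] t by auto
  have [simp]: "s \<in> carrier R" using s T_carrier by blast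
  have "(s \<otimes> a) [^] Suc n = (s [^] n \<otimes> a) \<otimes> (s \<otimes> a [^] n)"
    using t(1) by (simp add: R.nat_pow_distrib R.m_ac)
  also have "\<dots> \<in> J" using s t(1) Ji by (simp add: ideal.I_l_closed)
  finally have "s \<otimes> a \<in> J" using R.radical_idealD[OF J, of "s \<otimes> a" "Suc n"] t(1) by simp
  then have "h a \<in> extension J" using hom_mem_extension_iff[OF Ji ker] s t by auto
  then show "y \<in> extension J" using hom_unit_cancel[OF E t(2) y(1)] t(3) by simp
qed

text \<open>
  Every ideal of \<open>S\<close> is the extension of its contraction. A factorization of the contraction into
  radical ideals extends, since the factors contain the contraction and hence the kernel.
\<close>
lemma SSP_ring_image:
  assumes "SSP_ring R"
  shows "SSP_ring S"
  unfolding SSP_ring_def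
proof (intro conjI allI impI)
  show "cring S" by (rule S.is_cring)
  fix I assume I: "ideal I S"
  define C where "C = {a \<in> carrier R. h a \<in> I}"
  have C: "ideal C R" using ring.ideal_vimage[OF I] by (simp add: C_def)
  obtain Js where Js: "\<And>J. J \<in> set Js \<Longrightarrow> radical_ideal J R"
    "\<And>J. J \<in> set Js \<Longrightarrow> ideal J R" "\<And>J. J \<in> set Js \<Longrightarrow> C \<subseteq> J" "C = ideal_product R Js"
    using R.SSP_ringE[OF assms C] by metis
  have "I = extension C" using extension_contraction[OF I] by (simp add: C_def)
  also have "\<dots> = ideal_product S (map extension Js)"
    unfolding Js(4) by (rule extension_product[OF Js(2)])
  finally have "I = ideal_product S (map extension Js)" .
  moreover have "radical_ideal (extension J) S" if "J \<in> set Js" for J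
  proof (rule extension_radical[OF Js(1)[OF that]])
    fix a assume "a \<in> carrier R" "h a = \<zero>\<^bsub>S\<^esub>"
    then have "a \<in> C" using I by (simp add: C_def additive_subgroup.zero_closed ideal.axioms(1))
    then show "a \<in> J" using Js(3)[OF that] by blast
  qed
  ultimately show "\<exists>Js. (\<forall>J\<in>set Js. radical_ideal J S) \<and> I = ideal_product S Js"
    by (intro exI[of _ "map extension Js"]) auto
qed

lemma
  assumes J: "primeideal J R" and ker: "\<And>a. a \<in> carrier R \<Longrightarrow> h a = \<zero>\<^bsub>S\<^esub> \<Longrightarrow> a \<in> J"
    and JT: "J \<inter> T = {}"
  shows hom_mem_prime_extension: "a \<in> carrier R \<Longrightarrow> h a \<in> extension J \<longleftrightarrow> a \<in> J"
    and extension_prime: "primeideal (extension J) S"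
proof -
  note Ji = primeideal.axioms(1)[OF J]
  have iff: "h a \<in> extension J \<longleftrightarrow> a \<in> J" if a: "a \<in> carrier R" for a
  proof
    assume "h a \<in> extension J"
    then obtain t where t: "t \<in> T" "t \<otimes> a \<in> J" using hom_mem_extension_iff[OF Ji ker a] by blast
    then show "a \<in> J" using primeideal.I_prime[OF J T_carrier[OF t(1)] a] JT by blast
  qed (use a hom_mem_extension in blast)
  then show "a \<in> carrier R \<Longrightarrow> h a \<in> extension J \<longleftrightarrow> a \<in> J" .
  note E = extension_ideal[OF Ji]
  show "primeideal (extension J) S"
  proof (rule primeidealI[OF E S.is_cring])
    have "h \<one> \<notin> extension J" using iff[of \<one>] JT T_one by auto
    then show "carrier S \<noteq> extension J" by auto
    fix x y assume x: "x \<in> carrier S" and y: "y \<in> carrier S" and xy: "x \<otimes>\<^bsub>S\<^esub> y \<in> extension J"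
    obtain a s where s: "a \<in> carrier R" "s \<in> T" "h s \<otimes>\<^bsub>S\<^esub> x = h a" using fraction[OF x] by blast
    obtain b t where t: "b \<in> carrier R" "t \<in> T" "h t \<otimes>\<^bsub>S\<^esub> y = h b" using fraction[OF y] by blast
    have [simp]: "s \<in> carrier R" "t \<in> carrier R" using s t T_carrier by blast+
    have "h (a \<otimes> b) = (h s \<otimes>\<^bsub>S\<^esub> x) \<otimes>\<^bsub>S\<^esub> (h t \<otimes>\<^bsub>S\<^esub> y)" using s t by simp
    also have "\<dots> = (h s \<otimes>\<^bsub>S\<^esub> h t) \<otimes>\<^bsub>S\<^esub> (x \<otimes>\<^bsub>S\<^esub> y)" using x y by (simp add: S.m_ac)
    also have "\<dots> \<in> extension J" using xy E by (simp add: ideal.I_l_closed)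
    finally have "a \<otimes> b \<in> J" using iff[of "a \<otimes> b"] s(1) t(1) by blast
    then have "a \<in> J \<or> b \<in> J" using primeideal.I_prime[OF J] s t by simp
    then have "h a \<in> extension J \<or> h b \<in> extension J" using iff s t by blast
    then show "x \<in> extension J \<or> y \<in> extension J"
      using hom_unit_cancel[OF E s(2) x] hom_unit_cancel[OF E t(2) y] s(3) t(3) by auto
  qed
qed

end

lemma (in cring) quotient_fraction_hom:
  assumes "ideal I R"
  shows "fraction_hom R (R Quot I) ((+>) I) {\<one>}"
proof -
  interpret Q: ring_hom_cring R "R Quot I" "(+>) I"
    by (rule ideal.rcos_ring_hom_cring[OF assms is_cring])
  show ?thesis
  proof
    fix t assume "t \<in> {\<one>}"
    then show "I +> t \<in> Units (R Quot I)" using Q.hom_one Q.S.Units_one_closed by simp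
  next
    fix y assume "y \<in> carrier (R Quot I)"
    then obtain a where "a \<in> carrier R" "y = I +> a"
      unfolding FactRing_def A_RCOSETS_def' by auto
    moreover from this have "(I +> \<one>) \<otimes>\<^bsub>R Quot I\<^esub> y = I +> a"
      using Q.S.l_one[OF Q.hom_closed[of a]] by (simp only: Q.hom_one)
    ultimately show "\<exists>a\<in>carrier R. \<exists>t\<in>{\<one>}. (I +> t) \<otimes>\<^bsub>R Quot I\<^esub> y = I +> a"
      by blast
  qed auto
qed

lemma (in cring) quotient_zero_iff:
  assumes "ideal I R" "a \<in> carrier R"
  shows "I +> a = \<zero>\<^bsub>R Quot I\<^esub> \<longleftrightarrow> a \<in> I"
  using ideal.rcos_const_imp_mem[OF assms(1)] a_rcos_zero[OF assms(1)] assms(2)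
  by (auto simp: FactRing_def)

text \<open>
  The properties of the canonical map to the localization at a prime \<open>N\<close> that characterize it, so that
  later arguments do not have to look at classes of pairs.
\<close>
locale prime_localization = fraction_hom R S h "carrier R - N"
  for R (structure) and S (structure) and h and N +
  assumes N: "primeideal N R"
    and hom_zero: "\<lbrakk>a \<in> carrier R; h a = \<zero>\<^bsub>S\<^esub>\<rbrakk> \<Longrightarrow> \<exists>u\<in>carrier R - N. u \<otimes> a = \<zero>"

lemma (in cring) prime_complement_submonoid:
  assumes "primeideal P R"
  shows "submonoid (carrier R - P) R"
proof
  show "\<one> \<in> carrier R - P"
    using ideal.one_imp_carrier[OF primeideal.axioms(1)[OF assms]] primeideal.I_notcarr[OF assms] by auto
  fix x y assume "x \<in> carrier R - P" "y \<in> carrier R - P"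
  then show "x \<otimes> y \<in> carrier R - P" using primeideal.I_prime[OF assms] by auto
qed auto

lemma (in cring) prime_localization_at:
  assumes P: "primeideal P R"
  shows "prime_localization R (localization_at R P) (\<lambda>a. frac_class R (carrier R - P) a \<one>) P"
proof -
  let ?T = "carrier R - P" and ?L = "localization_at R P"
  let ?h = "\<lambda>a. frac_class R ?T a \<one>"
  have sm: "submonoid ?T R" by (rule prime_complement_submonoid[OF P])
  note mult = mult_frac[OF sm, folded localization_at_def]
    and add = add_frac[OF sm, folded localization_at_def]
    and eq = frac_eq_iff[OF sm] and one = S_one[OF sm]
    and cL = carrier_localization[OF sm, folded localization_at_def]
  interpret L: cring ?L using cring_localization[OF sm] by (simp add: localization_at_def)
  have Lone: "\<one>\<^bsub>?L\<^esub> = ?h \<one>" and Lzero: "\<zero>\<^bsub>?L\<^esub> = ?h \<zero>"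
    by (simp_all add: localization_at_def localization_def)
  have mem: "frac_class R ?T a s \<in> carrier ?L" if "a \<in> carrier R" "s \<in> ?T" for a s
    using that cL by blast
  have h: "?h \<in> ring_hom R ?L"
    by (rule ring_hom_memI) (use one mem Lone in \<open>auto simp: mult add\<close>)
  have hc: "ring_hom_cring R ?L ?h"
    by (intro ring_hom_cring.intro ring_hom_cring_axioms.intro is_cring L.is_cring h)
  show ?thesis
  proof (intro prime_localization.intro fraction_hom.intro fraction_hom_axioms.intro
      prime_localization_axioms.intro hc sm P)
    fix t assume t: "t \<in> ?T"
    have "frac_class R ?T (t \<otimes> \<one>) (\<one> \<otimes> t) = frac_class R ?T \<one> \<one>"
      using t one by (subst eq) auto
    then have "?h t \<otimes>\<^bsub>?L\<^esub> frac_class R ?T \<one> t = \<one>\<^bsub>?L\<^esub>"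
      using t one Lone by (simp add: mult)
    then show "?h t \<in> Units ?L"
      using mem t one L.m_comm unfolding Units_def by (auto intro!: bexI[of _ "frac_class R ?T \<one> t"])
  next
    fix y assume "y \<in> carrier ?L"
    then obtain a s where y: "y = frac_class R ?T a s" "a \<in> carrier R" "s \<in> ?T" using cL by blast
    have "frac_class R ?T (s \<otimes> a) (\<one> \<otimes> s) = ?h a"
      using y one by (subst eq) auto
    then have "?h s \<otimes>\<^bsub>?L\<^esub> y = ?h a" using y one by (simp add: mult)
    then show "\<exists>a\<in>carrier R. \<exists>t\<in>?T. ?h t \<otimes>\<^bsub>?L\<^esub> y = ?h a" using y by blast
  next
    fix a assume "a \<in> carrier R" "?h a = \<zero>\<^bsub>?L\<^esub>"
    then show "\<exists>u\<in>?T. u \<otimes> a = \<zero>"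
      using eq[of a \<one> \<zero> \<one>] one Lzero by auto
  qed
qed

context prime_localization
begin

lemma hom_zero_mem_prime:
  assumes "primeideal P R" "P \<subseteq> N" "a \<in> carrier R" "h a = \<zero>\<^bsub>S\<^esub>"
  shows "a \<in> P"
proof -
  obtain u where u: "u \<in> carrier R - N" "u \<otimes> a = \<zero>" using hom_zero assms by blast
  have "\<zero> \<in> P" using assms(1) by (simp add: additive_subgroup.zero_closed ideal.axioms(1) primeideal.axioms(1))
  then show ?thesis using primeideal.I_prime[OF assms(1), of u a] u assms by auto
qed

lemma prime_disjoint: "P \<subseteq> N \<Longrightarrow> P \<inter> (carrier R - N) = {}"
  by blast

lemma nonunits_eq: "nonunits S = extension N"
proof -
  note NN = N hom_zero_mem_prime[OF N order_refl] prime_disjoint[OF order_refl]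
  have E: "primeideal (extension N) S" by (rule extension_prime) (use NN in auto)
  note Ei = primeideal.axioms(1)[OF E]
  show ?thesis
  proof
    show "extension N \<subseteq> nonunits S"
      using S.proper_ideal_nonunits[OF Ei] primeideal.I_notcarr[OF E] by auto
    show "nonunits S \<subseteq> extension N"
    proof
      fix y assume y: "y \<in> nonunits S"
      then have yc: "y \<in> carrier S" by (simp add: nonunits_def)
      obtain a t where t: "a \<in> carrier R" "t \<in> carrier R - N" "h t \<otimes>\<^bsub>S\<^esub> y = h a"
        using fraction[OF yc] by blast
      have "a \<in> N"
      proof (rule ccontr)
        assume "a \<notin> N"
        then have "h a \<in> Units S" "h t \<in> Units S" using hom_Units t by auto
        then have "inv\<^bsub>S\<^esub> (h t) \<otimes>\<^bsub>S\<^esub> (h t \<otimes>\<^bsub>S\<^esub> y) \<in> Units S" using t(3) by simp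
        moreover have "inv\<^bsub>S\<^esub> (h t) \<otimes>\<^bsub>S\<^esub> (h t \<otimes>\<^bsub>S\<^esub> y) = y"
          using S.m_assoc[of "inv\<^bsub>S\<^esub> (h t)" "h t" y] yc \<open>h t \<in> Units S\<close>
            S.Units_closed[OF \<open>h t \<in> Units S\<close>] by simp
        ultimately show False using y by (simp add: nonunits_def)
      qed
      then show "y \<in> extension N" unfolding extension_def using t yc by blast
    qed
  qed
qed

lemma local_cring_image: "local_cring S"
  by (intro local_cring.intro local_cring_axioms.intro S.is_cring)
    (simp add: nonunits_eq extension_ideal primeideal.axioms(1)[OF N])

lemma hom_nonunit: "a \<in> N \<Longrightarrow> h a \<in> nonunits S"
  using hom_mem_extension ideal.Icarr[OF primeideal.axioms(1)[OF N]] by (simp add: nonunits_eq)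

text \<open>
  Minimality of \<open>N\<close> over \<open>I\<close> becomes the statement that the maximal ideal of the localization is nil
  modulo any ideal containing the image of \<open>I\<close>.
\<close>
lemma nonunits_nilpotent:
  assumes "\<And>a. a \<in> N \<Longrightarrow> \<exists>s\<in>carrier R - N. \<exists>n::nat. s \<otimes> a [^] n \<in> I"
    and I': "ideal I' S" "\<And>a. a \<in> I \<Longrightarrow> h a \<in> I'" and y: "y \<in> nonunits S"
  shows "\<exists>n::nat. y [^]\<^bsub>S\<^esub> n \<in> I'"
proof -
  obtain t a where t: "t \<in> carrier R - N" "a \<in> N" "h t \<otimes>\<^bsub>S\<^esub> y = h a" and yc: "y \<in> carrier S"
    using y unfolding nonunits_eq extension_def by blast
  obtain s n where s: "s \<in> carrier R - N" "s \<otimes> a [^] (n::nat) \<in> I" using assms(1)[OF t(2)] by blast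
  have [simp]: "a \<in> carrier R" using t(2) ideal.Icarr[OF primeideal.axioms(1)[OF N]] by blast
  have "h (s \<otimes> a [^] n) = h s \<otimes>\<^bsub>S\<^esub> (h t \<otimes>\<^bsub>S\<^esub> y) [^]\<^bsub>S\<^esub> n"
    using s t by (simp add: ring.hom_nat_pow)
  also have "\<dots> = h (s \<otimes> t [^] n) \<otimes>\<^bsub>S\<^esub> y [^]\<^bsub>S\<^esub> n"
    using s(1) t(1) yc by (simp add: S.nat_pow_distrib S.m_ac ring.hom_nat_pow)
  finally have "h (s \<otimes> t [^] n) \<otimes>\<^bsub>S\<^esub> y [^]\<^bsub>S\<^esub> n \<in> I'" using I'(2)[OF s(2)] by simp
  moreover have "t [^] n \<in> carrier R - N" using T_one t(1) by (induct n) (auto dest: primeideal.I_prime[OF N, rotated 2])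
  ultimately have "y [^]\<^bsub>S\<^esub> n \<in> I'"
    using hom_unit_cancel[OF I'(1) T_mult[OF s(1)]] yc by simp
  then show ?thesis by blast
qed

lemma hom_zero_domain:
  assumes "domain R" "a \<in> carrier R" "h a = \<zero>\<^bsub>S\<^esub>"
  shows "a = \<zero>"
  using hom_zero_mem_prime[OF domain.zeroprimeideal[OF assms(1)] _ assms(2,3)] N
  by (auto simp: additive_subgroup.zero_closed ideal.axioms(1) primeideal.axioms(1))

lemma domain_image:
  assumes "domain R"
  shows "domain S"
proof -
  have "primeideal (extension {\<zero>}) S"
    by (rule extension_prime[OF domain.zeroprimeideal[OF assms]])
      (use hom_zero_domain[OF assms] T_one N in
        \<open>auto simp: additive_subgroup.zero_closed ideal.axioms(1) primeideal.axioms(1)\<close>)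
  moreover have "extension {\<zero>} = {\<zero>\<^bsub>S\<^esub>}"
  proof
    show "extension {\<zero>} \<subseteq> {\<zero>\<^bsub>S\<^esub>}" by (rule extension_least[OF S.zeroideal]) simp
    show "{\<zero>\<^bsub>S\<^esub>} \<subseteq> extension {\<zero>}" using hom_mem_extension[of \<zero> "{\<zero>}"] by simp
  qed
  ultimately show ?thesis using S.zeroprimeideal_domainI by simp
qed

end

section \<open>The dimension of an SSP-ring\<close>

lemma (in cring) ideal_prod_finite_support:
  assumes "x \<in> I \<cdot> J"
  obtains F where "finite F" "F \<subseteq> I \<union> J" "\<And>K. F \<subseteq> K \<Longrightarrow> x \<in> K \<cdot> K"
proof -
  have "\<exists>F. finite F \<and> F \<subseteq> I \<union> J \<and> (\<forall>K. F \<subseteq> K \<longrightarrow> x \<in> K \<cdot> K)"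
    using assms
  proof induct
    case (prod i j)
    then show ?case by (intro exI[of _ "{i, j}"]) (auto intro: ideal_prod.prod)
  next
    case (sum x y)
    then obtain F G where "finite F" "F \<subseteq> I \<union> J" "\<forall>K. F \<subseteq> K \<longrightarrow> x \<in> K \<cdot> K"
      "finite G" "G \<subseteq> I \<union> J" "\<forall>K. G \<subseteq> K \<longrightarrow> y \<in> K \<cdot> K" by blast
    then show ?case by (intro exI[of _ "F \<union> G"]) (auto intro: ideal_prod.sum)
  qed
  then show thesis using that by blast
qed

text \<open>
  Membership in the square of the maximal ideal involves only finitely many nonunits, so it persists
  in the localization at a prime \<open>N\<close> minimal over these. The maximal ideal of that localization is
  principal, and there \<open>x\<close> still generates a radical ideal.
\<close>
lemma SSP_domain_radical_generator:
  fixes R (structure)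
  assumes dom: "domain R" and loc: "local_cring R" and SSP: "SSP_ring R"
    and x: "x \<in> nonunits R \<cdot> nonunits R" "radical_ideal (PIdl x) R"
  shows "x = \<zero>"
proof -
  interpret local_cring R by (rule loc)
  have xc: "x \<in> carrier R" using x(1) square_subset nonunits_carrier by blast
  obtain F where F: "finite F" "F \<subseteq> nonunits R \<union> nonunits R" "\<And>K. F \<subseteq> K \<Longrightarrow> x \<in> K \<cdot> K"
    using ideal_prod_finite_support[OF x(1)] by metis
  have Fc: "F \<subseteq> carrier R" using F(2) nonunits_carrier by blast
  have "Idl F \<subseteq> nonunits R" using F(2) by (intro genideal_minimal nonunits_ideal) auto
  then have "(carrier R - nonunits R) \<inter> Idl F = {}" by blast
  then obtain N where N: "primeideal N R" "Idl F \<subseteq> N"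
    "\<And>a. a \<in> N \<Longrightarrow> \<exists>s\<in>carrier R - N. \<exists>n::nat. s \<otimes> a [^] n \<in> Idl F"
    using minimal_prime_exists[OF genideal_ideal[OF Fc] prime_complement_submonoid[OF nonunits_prime]]
    by metis
  note Ni = primeideal.axioms(1)[OF N(1)]
  have FN: "F \<subseteq> N" using genideal_self[OF Fc] N(2) by blast
  let ?S = "localization_at R N" and ?h = "\<lambda>a. frac_class R (carrier R - N) a \<one>"
  interpret L: prime_localization R ?S ?h N by (rule prime_localization_at[OF N(1)])
  interpret S: local_cring ?S by (rule L.local_cring_image)
  let ?M = "nonunits ?S" and ?I = "Idl\<^bsub>?S\<^esub> (?h ` F)"
  have hFM: "?h ` F \<subseteq> ?M" using FN L.hom_nonunit by blast
  then have hFc: "?h ` F \<subseteq> carrier ?S" using S.nonunits_carrier by blast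
  note I = L.S.genideal_ideal[OF hFc]
  have "?I \<subseteq> ?M" by (rule L.S.genideal_minimal[OF S.nonunits_ideal hFM])
  then have Ic: "?I \<noteq> carrier ?S" using L.S.one_notin_nonunits by auto
  have "Idl F \<subseteq> {a \<in> carrier R. ?h a \<in> ?I}"
    using Fc L.S.genideal_self[OF hFc] by (intro genideal_minimal L.ring.ideal_vimage I) auto
  then have hI: "?h a \<in> ?I" if "a \<in> Idl F" for a using that by blast
  obtain z where z: "z \<in> ?M" "?M = PIdl\<^bsub>?S\<^esub> z"
    using S.SSP_nonunits_principal[OF L.SSP_ring_image[OF SSP] finite_imageI[OF F(1)] hFc Ic
        L.nonunits_nilpotent[OF N(3) I hI]] by metis
  have "?h x \<in> L.extension (N \<cdot> N)" using L.hom_mem_extension F(3)[OF FN] xc by blast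
  then have hx: "?h x \<in> ?M \<cdot>\<^bsub>?S\<^esub> ?M" by (simp add: L.nonunits_eq L.extension_prod[OF Ni Ni])
  have X: "ideal (PIdl x) R" by (rule cgenideal_ideal[OF xc])
  have "L.extension (PIdl x) = PIdl\<^bsub>?S\<^esub> (?h x)"
  proof
    show "L.extension (PIdl x) \<subseteq> PIdl\<^bsub>?S\<^esub> (?h x)"
      using xc by (intro L.extension_least L.S.cgenideal_ideal) (auto simp: mem_PIdl L.S.mem_PIdl)
    show "PIdl\<^bsub>?S\<^esub> (?h x) \<subseteq> L.extension (PIdl x)"
      using xc cgenideal_self by (intro L.S.cgenideal_minimal L.extension_ideal X L.hom_mem_extension)
  qed
  moreover have "radical_ideal (L.extension (PIdl x)) ?S"
  proof (rule L.extension_radical[OF x(2)])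
    fix a assume "a \<in> carrier R" "?h a = \<zero>\<^bsub>?S\<^esub>"
    then have "a = \<zero>" by (rule L.hom_zero_domain[OF dom])
    then show "a \<in> PIdl x" using X by (simp add: additive_subgroup.zero_closed ideal.axioms(1))
  qed
  ultimately have "?h x = \<zero>\<^bsub>?S\<^esub>" using S.radical_generator_in_square[OF z hx] by simp
  then show ?thesis using L.hom_zero_domain[OF dom xc] by simp
qed

text \<open>
  If all products \<open>a b\<close> with \<open>a \<in> J\<close> and \<open>b \<in> K\<close> were nonunit multiples of \<open>p\<close>, so would be their sum
  \<open>p\<close>. Hence some product \<open>a b\<close> is a unit multiple of \<open>p\<close>, and cancelling \<open>b\<close> shows that \<open>a\<close> generates \<open>J\<close>.
\<close>
lemma invertible_ideal_principal:
  fixes R (structure)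
  assumes "domain R" and loc: "local_cring R" and J: "ideal J R" and K: "ideal K R"
    and p: "p \<in> carrier R" "p \<noteq> \<zero>" and JK: "PIdl p = J \<cdot> K"
  obtains a where "a \<in> J" "J = PIdl a"
proof -
  interpret domain R by fact
  interpret local_cring R by (rule loc)
  have pJK: "p \<in> J \<cdot> K" using cgenideal_self[OF p(1)] JK by simp
  have "\<exists>a\<in>J. \<exists>b\<in>K. \<forall>c\<in>nonunits R. a \<otimes> b \<noteq> c \<otimes> p"
  proof (rule ccontr)
    assume neg: "\<not> ?thesis"
    have "J \<cdot> K \<subseteq> nonunits R \<cdot> (PIdl p)"
    proof (rule ideal_prod_subset_ideal)
      show "ideal (nonunits R \<cdot> (PIdl p)) R"
        using ideal_prod_is_ideal[OF nonunits_ideal cgenideal_ideal[OF p(1)]] .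
      fix a b assume "a \<in> J" "b \<in> K"
      then obtain c where "c \<in> nonunits R" "a \<otimes> b = c \<otimes> p" using neg by blast
      then show "a \<otimes> b \<in> nonunits R \<cdot> (PIdl p)" using ideal_prod.prod cgenideal_self[OF p(1)] by metis
    qed
    then obtain m where m: "m \<in> nonunits R" "p = m \<otimes> p"
      using mem_prod_PIdl[OF nonunits_ideal p(1)] pJK by blast
    have "(\<one> \<ominus> m) \<otimes> p = p \<ominus> m \<otimes> p"
      using p(1) nonunits_carrier[OF m(1)] by algebra
    also have "\<dots> = \<zero>" using p(1) m(2) by (simp add: a_minus_def r_neg)
    finally show False using unit_cancel_ideal[OF zeroideal m(1) p(1)] p(2) by simp
  qed
  then obtain a b where ab: "a \<in> J" "b \<in> K" "\<And>c. c \<in> nonunits R \<Longrightarrow> a \<otimes> b \<noteq> c \<otimes> p" by blast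
  have ac: "a \<in> carrier R" "b \<in> carrier R" using ab J K ideal.Icarr by fast+
  have "a \<otimes> b \<in> PIdl p" using ab JK ideal_prod.prod by metis
  then obtain c where c: "c \<in> carrier R" "a \<otimes> b = c \<otimes> p" by (auto simp: mem_PIdl)
  then have cu: "c \<in> Units R" using ab(3) by (auto simp: nonunits_def)
  have "b \<noteq> \<zero>"
  proof
    assume "b = \<zero>"
    then have "c \<otimes> p = \<zero>" using c ac by simp
    then have "c = \<zero>" using integral_iff c(1) p by simp
    moreover have "\<zero> \<in> nonunits R"
      using nonunits_ideal by (simp add: additive_subgroup.zero_closed ideal.axioms(1))
    ultimately show False using cu by (simp add: nonunits_def)
  qed
  have "J \<subseteq> PIdl a"
  proof
    fix j assume j: "j \<in> J"
    then have jc: "j \<in> carrier R" using J ideal.Icarr by fast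
    have "j \<otimes> b \<in> PIdl p" using ab j JK ideal_prod.prod by metis
    then obtain d where d: "d \<in> carrier R" "j \<otimes> b = d \<otimes> p" by (auto simp: mem_PIdl)
    have "p = inv c \<otimes> (a \<otimes> b)"
      unfolding c(2) using cu c(1) p(1) m_assoc[of "inv c" c p] by simp
    then have "j \<otimes> b = (d \<otimes> inv c \<otimes> a) \<otimes> b"
      using d ac cu by (simp add: m_assoc)
    then have "j = d \<otimes> inv c \<otimes> a"
      using m_rcancel[OF \<open>b \<noteq> \<zero>\<close> ac(2) jc, of "d \<otimes> inv c \<otimes> a"] d ac cu by simp
    then show "j \<in> PIdl a" using d cu by (auto simp: mem_PIdl)
  qed
  then show thesis using that[OF ab(1)] cgenideal_minimal[OF J ab(1)] by blast
qed

lemma (in fraction_hom) hom_mem_extension_add: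
  assumes "ideal J R" "y \<in> carrier R" "a \<in> J <+> PIdl y"
  shows "h a \<in> extension J <+>\<^bsub>S\<^esub> PIdl\<^bsub>S\<^esub> (h y)"
proof -
  obtain q r where q: "q \<in> J" "r \<in> carrier R" "a = q \<oplus> r \<otimes> y"
    using assms(3) by (auto simp: mem_set_add R.mem_PIdl)
  have qc: "q \<in> carrier R" using q(1) assms(1) ideal.Icarr by fast
  have "h a = h q \<oplus>\<^bsub>S\<^esub> h r \<otimes>\<^bsub>S\<^esub> h y" using q qc assms(2) by simp
  moreover have "h r \<otimes>\<^bsub>S\<^esub> h y \<in> PIdl\<^bsub>S\<^esub> (h y)" using q(2) by (auto simp: S.mem_PIdl)
  ultimately show ?thesis using hom_mem_extension[OF q(1) qc] unfolding mem_set_add by blast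
qed

text \<open>
  After localizing at a prime minimal over \<open>P + (y)\<close>, with \<open>y \<in> Q\<close> outside \<open>P\<close>, the prime \<open>P\<close> lies in the
  square of the maximal ideal. For a nonzero \<open>p \<in> P\<close> some radical factor of \<open>(p)\<close> lies in \<open>P\<close>, and
  it has a nonzero generator, contrary to the preceding result on such generators.
\<close>
lemma SSP_domain_primes_incomparable:
  fixes R (structure)
  assumes dom: "domain R" and SSP: "SSP_ring R"
    and P: "primeideal P R" "P \<noteq> {\<zero>}" and Q: "primeideal Q R" "P \<subset> Q"
  shows False
proof -
  interpret domain R by (rule dom)
  note Pi = primeideal.axioms(1)[OF P(1)] and Qi = primeideal.axioms(1)[OF Q(1)]
  obtain y where y: "y \<in> Q" "y \<notin> P" using Q(2) by blast
  have yc: "y \<in> carrier R" using y(1) Qi ideal.Icarr by fast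
  let ?I = "P <+> PIdl y"
  have Y: "ideal (PIdl y) R" by (rule cgenideal_ideal[OF yc])
  note I = add_ideals[OF Pi Y] and sub = subset_set_add[OF Pi Y]
  have "?I \<subseteq> Q" using Q y Qi by (intro set_add_subset cgenideal_minimal) auto
  then have "(carrier R - Q) \<inter> ?I = {}" by blast
  then obtain N where N: "primeideal N R" "?I \<subseteq> N"
    "\<And>a. a \<in> N \<Longrightarrow> \<exists>s\<in>carrier R - N. \<exists>n::nat. s \<otimes> a [^] n \<in> ?I"
    using minimal_prime_exists[OF I prime_complement_submonoid[OF Q(1)]] by metis
  have PN: "P \<subseteq> N" and yN: "y \<in> N" using N(2) sub cgenideal_self[OF yc] by blast+
  let ?S = "localization_at R N" and ?h = "\<lambda>a. frac_class R (carrier R - N) a \<one>"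
  interpret L: prime_localization R ?S ?h N by (rule prime_localization_at[OF N(1)])
  interpret S: local_cring ?S by (rule L.local_cring_image)
  note SSP' = L.SSP_ring_image[OF SSP] and dom' = L.domain_image[OF dom]
  let ?P = "L.extension P" and ?M = "nonunits ?S"
  note ker = L.hom_zero_mem_prime[OF P(1) PN] and dis = L.prime_disjoint[OF PN]
  have P': "primeideal ?P ?S" by (rule L.extension_prime[OF P(1) ker dis])
  note Pi' = primeideal.axioms(1)[OF P']
  have hyP: "?h y \<notin> ?P" using L.hom_mem_prime_extension[OF P(1) ker dis yc] y(2) by simp
  have hyM: "?h y \<in> ?M" by (rule L.hom_nonunit[OF yN])
  have Y': "ideal (PIdl\<^bsub>?S\<^esub> (?h y)) ?S" by (rule L.S.cgenideal_ideal) (simp add: yc)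
  let ?I' = "?P <+>\<^bsub>?S\<^esub> PIdl\<^bsub>?S\<^esub> (?h y)"
  have hI: "?h a \<in> ?I'" if "a \<in> ?I" for a
    by (rule L.hom_mem_extension_add[OF Pi yc that])
  have PM: "?P \<subseteq> ?M \<cdot>\<^bsub>?S\<^esub> ?M"
    by (rule S.SSP_prime_subset_square(1)[OF SSP' P' hyM hyP
          L.nonunits_nilpotent[OF N(3) L.S.add_ideals[OF Pi' Y'] hI]])
  have "\<zero> \<in> P" using Pi by (simp add: additive_subgroup.zero_closed ideal.axioms(1))
  then obtain p where p: "p \<in> P" "p \<noteq> \<zero>" using P(2) by blast
  have pc: "p \<in> carrier R" using p Pi ideal.Icarr by fast
  have hp: "?h p \<in> carrier ?S" "?h p \<noteq> \<zero>\<^bsub>?S\<^esub>" "?h p \<in> ?P"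
    using pc p L.hom_zero_domain[OF dom pc] L.hom_mem_extension[OF p(1) pc] by auto
  obtain Js where Js: "\<And>J. J \<in> set Js \<Longrightarrow> radical_ideal J ?S" "\<And>J. J \<in> set Js \<Longrightarrow> ideal J ?S"
    "PIdl\<^bsub>?S\<^esub> (?h p) = ideal_product ?S Js"
    using L.S.SSP_ringE[OF SSP' L.S.cgenideal_ideal[OF hp(1)]] by metis
  have "ideal_product ?S Js \<subseteq> ?P"
    using L.S.cgenideal_minimal[OF Pi' hp(3)] Js(3) by simp
  then obtain J where J: "J \<in> set Js" "J \<subseteq> ?P"
    using L.S.prime_contains_factor[OF P' Js(2)] by blast
  obtain K where K: "ideal K ?S" "ideal_product ?S Js = J \<cdot>\<^bsub>?S\<^esub> K"
    using L.S.ideal_product_split[OF Js(2) J(1)] by metis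
  note JK = Js(3)[unfolded K(2)]
  obtain a where a: "a \<in> J" "J = PIdl\<^bsub>?S\<^esub> a"
    using invertible_ideal_principal[OF dom' L.local_cring_image Js(2)[OF J(1)] K(1) hp(1,2) JK] by metis
  have "a = \<zero>\<^bsub>?S\<^esub>"
    using SSP_domain_radical_generator[OF dom' L.local_cring_image SSP', of a] a J PM Js(1) by auto
  then have "J = {\<zero>\<^bsub>?S\<^esub>}"
    using a(2) L.S.cgenideal_eq_genideal L.S.genideal_zero by simp
  then have "PIdl\<^bsub>?S\<^esub> (?h p) \<subseteq> {\<zero>\<^bsub>?S\<^esub>}"
    using JK L.S.ideal_prod_inter[OF Js(2)[OF J(1)] K(1)] by auto
  then show False using L.S.cgenideal_self[OF hp(1)] hp(2) by blast
qed

lemma (in cring) SSP_no_prime_chain: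
  assumes SSP: "SSP_ring R" and P0: "primeideal P\<^sub>0 R" and P1: "primeideal P\<^sub>1 R" and P2: "primeideal P\<^sub>2 R"
    and lt: "P\<^sub>0 \<subset> P\<^sub>1" "P\<^sub>1 \<subset> P\<^sub>2"
  shows False
proof -
  note P0i = primeideal.axioms(1)[OF P0]
  interpret D: fraction_hom R "R Quot P\<^sub>0" "(+>) P\<^sub>0" "{\<one>}" by (rule quotient_fraction_hom[OF P0i])
  have one: "P \<inter> {\<one>} = {}" if "primeideal P R" for P
    using primeideal.I_notcarr[OF that] ideal.one_imp_carrier[OF primeideal.axioms(1)[OF that]] by auto
  have ker: "a \<in> P\<^sub>0" if "a \<in> carrier R" "P\<^sub>0 +> a = \<zero>\<^bsub>R Quot P\<^sub>0\<^esub>" for a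
    using quotient_zero_iff[OF P0i] that by blast
  have ker1: "a \<in> P\<^sub>1" and ker2: "a \<in> P\<^sub>2" if "a \<in> carrier R" "P\<^sub>0 +> a = \<zero>\<^bsub>R Quot P\<^sub>0\<^esub>" for a
    using ker[OF that] lt by auto
  obtain a b where a: "a \<in> P\<^sub>1" "a \<notin> P\<^sub>0" and b: "b \<in> P\<^sub>2" "b \<notin> P\<^sub>1" using lt by blast
  have c: "a \<in> carrier R" "b \<in> carrier R"
    using a b P1 P2 ideal.Icarr primeideal.axioms(1) by fast+
  have "P\<^sub>0 +> a \<in> D.extension P\<^sub>1" "P\<^sub>0 +> a \<noteq> \<zero>\<^bsub>R Quot P\<^sub>0\<^esub>"
    using D.hom_mem_extension[OF a(1) c(1)] quotient_zero_iff[OF P0i c(1)] a(2) by auto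
  then have nz: "D.extension P\<^sub>1 \<noteq> {\<zero>\<^bsub>R Quot P\<^sub>0\<^esub>}" by blast
  have "P\<^sub>0 +> b \<in> D.extension P\<^sub>2" "P\<^sub>0 +> b \<notin> D.extension P\<^sub>1"
    using D.hom_mem_extension[OF b(1) c(2)] D.hom_mem_prime_extension[OF P1 ker1 one[OF P1] c(2)] b(2)
    by auto
  moreover have "D.extension P\<^sub>1 \<subseteq> D.extension P\<^sub>2" using lt unfolding D.extension_def by blast
  ultimately have "D.extension P\<^sub>1 \<subset> D.extension P\<^sub>2" by blast
  then show False
    using SSP_domain_primes_incomparable[OF primeideal.quotient_is_domain[OF P0] D.SSP_ring_image[OF SSP]
        D.extension_prime[OF P1 ker1 one[OF P1]] nz D.extension_prime[OF P2 ker2 one[OF P2]]] by blast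
qed

section \<open>Local SSP-rings\<close>

lemma (in cring) prime_avoiding_powers:
  assumes "ideal I R" "a \<in> carrier R" "\<And>n::nat. a [^] n \<notin> I"
  obtains P where "primeideal P R" "I \<subseteq> P" "a \<notin> P"
proof -
  let ?T = "range (\<lambda>n::nat. a [^] n)"
  have "submonoid ?T R"
  proof
    show "?T \<subseteq> carrier R" using assms(2) by auto
    show "\<one> \<in> ?T" using nat_pow_0[of a] by (metis rangeI)
    fix x y assume "x \<in> ?T" "y \<in> ?T"
    then show "x \<otimes> y \<in> ?T" using nat_pow_mult[OF assms(2)] by (auto simp: image_iff)
  qed
  moreover have "?T \<inter> I = {}" using assms(3) by auto
  ultimately obtain P where P: "primeideal P R" "I \<subseteq> P" "P \<inter> ?T = {}"
    using minimal_prime_exists[OF assms(1)] by metis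
  have "a = a [^] (1::nat)" using assms(2) by simp
  then have "a \<in> ?T" by (metis rangeI)
  then show thesis using that[OF P(1,2)] P(3) by blast
qed

lemma (in cring) prime_radical:
  assumes "primeideal P R"
  shows "radical_ideal P R"
proof (rule radical_idealI[OF primeideal.axioms(1)[OF assms]])
  fix x and n :: nat assume "x \<in> carrier R" "x [^] n \<in> P"
  then show "x \<in> P"
  proof (induct n)
    case 0
    then show ?case
      using primeideal.I_notcarr[OF assms] ideal.one_imp_carrier[OF primeideal.axioms(1)[OF assms]] by simp
  next
    case (Suc n)
    then show ?case using primeideal.I_prime[OF assms, of "x [^] n" x] by auto
  qed
qed

context local_cring
begin

lemma prime_subset_nonunits:
  assumes "primeideal P R"
  shows "P \<subseteq> nonunits R"
  using proper_ideal_nonunits[OF primeideal.axioms(1)[OF assms]] primeideal.I_notcarr[OF assms] by simp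

lemma SSP_special_primary:
  assumes SSP: "SSP_ring R" and prime: "\<And>P. primeideal P R \<Longrightarrow> P = nonunits R"
  shows "special_primary_ring R"
  unfolding special_primary_ring_def
proof (intro conjI exI[of _ "nonunits R"] allI impI is_cring)
  show "{P. primeideal P R} = {nonunits R}" using prime nonunits_prime by blast
  fix I assume "ideal I R \<and> I \<noteq> carrier R"
  then have I: "ideal I R" by simp
  have "\<exists>n::nat. a [^] n \<in> I" if a: "a \<in> nonunits R" for a
  proof (rule ccontr)
    assume "\<not> ?thesis"
    then obtain P where "primeideal P R" "a \<notin> P"
      using prime_avoiding_powers[OF I nonunits_carrier[OF a]] by blast
    then show False using prime a by blast
  qed
  then show "\<exists>n::nat. I = nonunits R [^]\<^bsub>ideals_set R\<^esub> n"
    using SSP_power_of_nonunits[OF SSP I] by metis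
qed

text \<open>
  Since there are no chains of three primes, the maximal ideal is the only prime containing
  \<open>P + (y)\<close> when \<open>y\<close> is a nonunit outside \<open>P\<close>.
\<close>
lemma SSP_nonmaximal_prime:
  assumes SSP: "SSP_ring R" and P: "primeideal P R" "P \<noteq> nonunits R"
  shows "P \<subseteq> nonunits R \<cdot> nonunits R" "nonunits R \<cdot> nonunits R \<noteq> nonunits R"
proof -
  note Pi = primeideal.axioms(1)[OF P(1)] and PM = prime_subset_nonunits[OF P(1)]
  obtain y where y: "y \<in> nonunits R" "y \<notin> P" using PM P(2) by blast
  let ?I = "P <+> PIdl y"
  have Y: "ideal (PIdl y) R" "y \<in> PIdl y"
    using y nonunits_carrier cgenideal_ideal cgenideal_self by auto
  note I = add_ideals[OF Pi Y(1)] and sub = subset_set_add[OF Pi Y(1)]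
  have nil: "\<exists>n::nat. a [^] n \<in> ?I" if a: "a \<in> nonunits R" for a
  proof (rule ccontr)
    assume "\<not> ?thesis"
    then obtain Q where Q: "primeideal Q R" "?I \<subseteq> Q" "a \<notin> Q"
      using prime_avoiding_powers[OF I nonunits_carrier[OF a]] by blast
    then have "P \<subset> Q" "Q \<subset> nonunits R"
      using sub Y(2) y(2) a prime_subset_nonunits[OF Q(1)] by blast+
    then show False using SSP_no_prime_chain[OF SSP P(1) Q(1) nonunits_prime] by blast
  qed
  show "P \<subseteq> nonunits R \<cdot> nonunits R" "nonunits R \<cdot> nonunits R \<noteq> nonunits R"
    by (rule SSP_prime_subset_square[OF SSP P(1) y nil]; assumption)+
qed

text \<open>
  Take \<open>z\<close> outside the square of the maximal ideal. Then \<open>(z)\<close> is radical, and the maximal ideal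
  is the only prime containing it because all others lie in the square.
\<close>
lemma SSP_uniformizer:
  assumes SSP: "SSP_ring R" and P: "primeideal P R" "P \<noteq> nonunits R"
  obtains z where "z \<in> nonunits R" "nonunits R = PIdl z" "\<And>n::nat. z [^] n \<noteq> \<zero>"
proof -
  let ?M = "nonunits R"
  note sq = SSP_nonmaximal_prime[OF SSP]
  obtain z where z: "z \<in> ?M" "z \<notin> ?M \<cdot> ?M" using sq(2)[OF P] square_subset by blast
  have zc: "z \<in> carrier R" using z nonunits_carrier by blast
  note Z = cgenideal_ideal[OF zc] and zZ = cgenideal_self[OF zc]
  have rad: "radical_ideal (PIdl z) R" using SSP_radical_or_square[OF SSP Z] z(2) zZ by blast
  have "?M \<subseteq> PIdl z"
  proof (rule ccontr)
    assume "\<not> ?thesis"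
    then obtain a where a: "a \<in> ?M" "a \<notin> PIdl z" by blast
    have ac: "a \<in> carrier R" using a nonunits_carrier by blast
    have "a [^] n \<notin> PIdl z" for n :: nat using radical_idealD[OF rad ac] a(2) by blast
    then obtain Q where Q: "primeideal Q R" "PIdl z \<subseteq> Q" "a \<notin> Q"
      using prime_avoiding_powers[OF Z ac] by blast
    then have "Q \<subseteq> ?M \<cdot> ?M" using sq(1)[OF Q(1)] a(1) by blast
    then show False using Q(2) zZ z(2) by blast
  qed
  then have "?M = PIdl z" using cgenideal_minimal[OF nonunits_ideal z(1)] by blast
  moreover have "z [^] n \<noteq> \<zero>" for n :: nat
  proof
    assume "z [^] n = \<zero>"
    then have "z [^] n \<in> P"
      using primeideal.axioms(1)[OF P(1)] by (simp add: additive_subgroup.zero_closed ideal.axioms(1))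
    then have "z \<in> P" using radical_idealD[OF prime_radical[OF P(1)] zc] by blast
    then show False using sq(1)[OF P] z(2) by blast
  qed
  ultimately show thesis using that z(1) by blast
qed

lemma ideal_product_power:
  assumes "\<And>J. J \<in> set Js \<Longrightarrow> z \<in> J" "z \<in> carrier R"
  shows "z [^] length Js \<in> ideal_product R Js"
  using assms(1)
proof (induct Js)
  case (Cons J Js)
  then have "z \<otimes> z [^] length Js \<in> J \<cdot> ideal_product R Js" by (intro ideal_prod.prod) auto
  moreover have "z \<otimes> z [^] length Js = z [^] length (J # Js)" using assms(2) by (simp add: m_comm)
  ultimately show ?case by simp
qed simp

text \<open>
  Let \<open>D\<close> be the set of elements that are not a unit times a power of \<open>z\<close>; they are divisible
  by all powers of \<open>z\<close>, and the quotients stay in \<open>D\<close>. If \<open>p \<in> D\<close>, some radical factor \<open>J\<close> of \<open>(p)\<close> lies in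
  \<open>D\<close>, as otherwise all factors contain \<open>z\<close> and \<open>p\<close> divides a power of \<open>z\<close>. Dividing an element of
  \<open>J\<close> by \<open>z\<close> does not lead out of any nonmaximal prime, nor out of the maximal ideal, which contains
  \<open>D\<close>; so it does not lead out of \<open>J\<close>, the intersection of the primes above it. Thus \<open>J = M J\<close>, hence \<open>(p) = M (p)\<close> and \<open>p = 0\<close>.
\<close>
lemma SSP_unit_times_power:
  assumes SSP: "SSP_ring R" and z: "z \<in> nonunits R" "nonunits R = PIdl z" "\<And>n::nat. z [^] n \<noteq> \<zero>"
    and p: "p \<in> carrier R" "p \<noteq> \<zero>"
  shows "\<exists>n::nat. \<exists>u\<in>Units R. p = u \<otimes> z [^] n"
proof (rule ccontr)
  assume neg: "\<not> ?thesis"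
  have zc [simp]: "z \<in> carrier R" using z(1) nonunits_carrier by blast
  define D where "D = {a \<in> carrier R. \<not> (\<exists>n::nat. \<exists>u\<in>Units R. a = u \<otimes> z [^] n)}"
  have pD: "p \<in> D" using neg p(1) by (simp add: D_def)
  have Dz: "\<exists>w\<in>D. a = w \<otimes> z" if a: "a \<in> D" for a
  proof -
    have ac: "a \<in> carrier R" using a by (simp add: D_def)
    have "a \<notin> Units R"
    proof
      assume "a \<in> Units R"
      moreover have "a = a \<otimes> z [^] (0::nat)" using ac by simp
      ultimately show False using a unfolding D_def by blast
    qed
    then have "a \<in> PIdl z" using ac z(2) by (auto simp: nonunits_def)
    then obtain w where w: "w \<in> carrier R" "a = w \<otimes> z" by (auto simp: mem_PIdl)
    have "w \<in> D"
    proof (rule ccontr)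
      assume "w \<notin> D"
      then obtain n u where u: "u \<in> Units R" "w = u \<otimes> z [^] (n::nat)" using w(1) by (auto simp: D_def)
      then have "a = u \<otimes> z [^] Suc n" using w(2) by (simp add: m_assoc Units_closed)
      then show False using a u(1) unfolding D_def by blast
    qed
    then show ?thesis using w(2) by blast
  qed
  have Dn: "\<exists>w\<in>D. a = w \<otimes> z [^] (n::nat)" if "a \<in> D" for a n
  proof (induct n)
    case 0
    then show ?case using that by (auto simp: D_def)
  next
    case (Suc n)
    then obtain w where w: "w \<in> D" "a = w \<otimes> z [^] n" by blast
    obtain w' where w': "w' \<in> D" "w = w' \<otimes> z" using Dz[OF w(1)] by blast
    have "w' \<in> carrier R" using w'(1) by (simp add: D_def)
    then have "a = w' \<otimes> z [^] Suc n" using w(2) w'(2) by (simp add: m_ac)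
    then show ?case using w'(1) by blast
  qed
  have DM: "D \<subseteq> nonunits R"
  proof
    fix a assume "a \<in> D"
    then obtain w where "w \<in> D" "a = w \<otimes> z" using Dz by blast
    then show "a \<in> nonunits R" using z(1) nonunits_ideal by (simp add: D_def ideal.I_l_closed)
  qed
  obtain Js where Js: "\<And>J. J \<in> set Js \<Longrightarrow> radical_ideal J R" "\<And>J. J \<in> set Js \<Longrightarrow> ideal J R"
    "PIdl p = ideal_product R Js"
    using SSP_ringE[OF SSP cgenideal_ideal[OF p(1)]] by metis
  have "\<exists>J\<in>set Js. J \<subseteq> D"
  proof (rule ccontr)
    assume no: "\<not> ?thesis"
    have zJ: "z \<in> J" if J: "J \<in> set Js" for J
    proof -
      obtain a where a: "a \<in> J" "a \<notin> D" using no J by blast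
      then obtain n u where u: "u \<in> Units R" "a = u \<otimes> z [^] (n::nat)"
        using ideal_carrier[OF Js(2)[OF J]] by (auto simp: D_def)
      have "inv u \<otimes> a \<in> J" using ideal.I_l_closed[OF Js(2)[OF J] a(1)] u(1) by blast
      moreover have "inv u \<otimes> a = z [^] n" using u by (simp add: m_assoc[symmetric] Units_closed)
      ultimately show ?thesis using radical_idealD[OF Js(1)[OF J] zc] by simp
    qed
    define k where "k = length Js"
    have "z [^] k \<in> PIdl p" unfolding Js(3) k_def by (rule ideal_product_power[OF zJ zc])
    then obtain r where r: "r \<in> carrier R" "z [^] k = r \<otimes> p" by (auto simp: mem_PIdl)
    obtain w where w: "w \<in> D" "p = w \<otimes> z [^] Suc k" using Dn[OF pD] by blast
    have wc: "w \<in> carrier R" using w(1) by (simp add: D_def)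
    have e: "z [^] k = (r \<otimes> w \<otimes> z) \<otimes> z [^] k"
      unfolding r(2) by (subst w(2)) (use r wc in \<open>simp add: m_ac r(2)[symmetric]\<close>)
    have m: "r \<otimes> w \<otimes> z \<in> nonunits R" using r(1) wc z(1) nonunits_ideal by (simp add: ideal.I_l_closed)
    have "(\<one> \<ominus> r \<otimes> w \<otimes> z) \<otimes> z [^] k = z [^] k \<ominus> (r \<otimes> w \<otimes> z) \<otimes> z [^] k"
      using nat_pow_closed[OF zc, of k] nonunits_carrier[OF m] by algebra
    also have "\<dots> = \<zero>" using e nonunits_carrier[OF m] by (simp add: a_minus_def r_neg)
    finally show False using unit_cancel_ideal[OF zeroideal m, of "z [^] k"] z(3)[of k] by simp
  qed
  then obtain J where J: "J \<in> set Js" "J \<subseteq> D" by blast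
  note Ji = Js(2)[OF J(1)]
  have "J \<subseteq> nonunits R \<cdot> J"
  proof
    fix x assume x: "x \<in> J"
    then obtain w where w: "w \<in> D" "x = w \<otimes> z" using J(2) Dz by blast
    have wc: "w \<in> carrier R" using w(1) by (simp add: D_def)
    have "w \<in> J"
    proof (rule ccontr)
      assume "w \<notin> J"
      then have "w [^] n \<notin> J" for n :: nat using radical_idealD[OF Js(1)[OF J(1)] wc] by blast
      then obtain Q where Q: "primeideal Q R" "J \<subseteq> Q" "w \<notin> Q"
        using prime_avoiding_powers[OF Ji wc] by blast
      then have "z \<in> Q" using primeideal.I_prime[OF Q(1) wc zc] x w(2) by blast
      then have "nonunits R \<subseteq> Q" unfolding z(2) by (rule cgenideal_minimal[OF primeideal.axioms(1)[OF Q(1)]])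
      then show False using w(1) DM Q(3) by blast
    qed
    then have "z \<otimes> w \<in> nonunits R \<cdot> J" by (rule ideal_prod.prod[OF z(1)])
    then show "x \<in> nonunits R \<cdot> J" using w wc by (simp add: m_comm)
  qed
  then have JJ: "J \<cdot> K \<subseteq> (nonunits R \<cdot> J) \<cdot> K" for K by (rule ideal_prod_mono[OF _ order_refl])
  obtain K where K: "ideal K R" "ideal_product R Js = J \<cdot> K"
    using ideal_product_split[OF Js(2) J(1)] by metis
  have "PIdl p \<subseteq> nonunits R \<cdot> (PIdl p)"
    using JJ[of K] K(2) Js(3) ideal_prod_assoc[OF nonunits_ideal Ji K(1)] by simp
  then obtain m where m: "m \<in> nonunits R" "p = m \<otimes> p"
    using mem_prod_PIdl[OF nonunits_ideal p(1)] cgenideal_self[OF p(1)] by blast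
  have "(\<one> \<ominus> m) \<otimes> p = p \<ominus> m \<otimes> p"
    using p(1) nonunits_carrier[OF m(1)] by algebra
  also have "\<dots> = \<zero>" using p(1) m(2) by (simp add: a_minus_def r_neg)
  finally show False using unit_cancel_ideal[OF zeroideal m(1) p(1)] p(2) by simp
qed

end

section \<open>Discrete valuations from uniformizers\<close>

locale uniformizer = cring +
  fixes z
  assumes z: "z \<in> carrier R" "z \<notin> Units R"
    and z_pow: "z [^] (n::nat) \<noteq> \<zero>"
    and unit_times_power: "\<lbrakk>a \<in> carrier R; a \<noteq> \<zero>\<rbrakk> \<Longrightarrow> \<exists>n::nat. \<exists>u\<in>Units R. a = u \<otimes> z [^] n"
begin

lemmas [simp] = z(1) Units_closed

lemma unit_power_nonzero:
  assumes "u \<in> Units R"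
  shows "u \<otimes> z [^] (n::nat) \<noteq> \<zero>"
proof
  assume "u \<otimes> z [^] n = \<zero>"
  then have "inv u \<otimes> (u \<otimes> z [^] n) = \<zero>" using assms by simp
  then show False using assms z z_pow[of n] by (simp add: m_assoc[symmetric] Units_closed)
qed

lemma unit_power_mult:
  assumes "u \<in> Units R" "v \<in> Units R"
  shows "(u \<otimes> z [^] (n::nat)) \<otimes> (v \<otimes> z [^] m) = (u \<otimes> v) \<otimes> z [^] (n + m)"
  using assms z by (simp add: nat_pow_mult[symmetric] m_ac)

lemma is_domain: "domain R"
proof (intro domain.intro domain_axioms.intro is_cring)
  show "\<one> \<noteq> \<zero>" using z_pow[of 0] by simp
  fix a b assume ab: "a \<otimes> b = \<zero>" "a \<in> carrier R" "b \<in> carrier R"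
  show "a = \<zero> \<or> b = \<zero>"
  proof (rule ccontr)
    assume "\<not> ?thesis"
    then obtain u n v m where "u \<in> Units R" "a = u \<otimes> z [^] (n::nat)" "v \<in> Units R" "b = v \<otimes> z [^] (m::nat)"
      using unit_times_power ab by meson
    then show False using ab(1) unit_power_mult unit_power_nonzero[of "u \<otimes> v" "n + m"] by simp
  qed
qed

sublocale dom: "domain" R by (rule is_domain)

definition ord :: "'a \<Rightarrow> nat" where
  "ord a = (SOME n. \<exists>u\<in>Units R. a = u \<otimes> z [^] n)"

lemma unit_power_unique:
  assumes "u \<in> Units R" "v \<in> Units R" "u \<otimes> z [^] (n::nat) = v \<otimes> z [^] m"
  shows "n \<le> m"
proof (rule ccontr)
  assume "\<not> n \<le> m"
  then obtain k where k: "n = Suc k + m" by (metis add.commute less_imp_Suc_add not_le add_Suc)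
  have "(u \<otimes> z [^] Suc k) \<otimes> z [^] m = v \<otimes> z [^] m"
    using assms z k by (simp add: nat_pow_mult[symmetric] m_ac)
  then have "u \<otimes> z [^] Suc k = v"
    using dom.m_rcancel[of "z [^] m" "u \<otimes> z [^] Suc k" v] z_pow assms z by simp
  then have v: "v = (u \<otimes> z [^] k) \<otimes> z" using assms(1) by (simp add: m_assoc)
  let ?w = "inv v \<otimes> (u \<otimes> z [^] k)"
  have "?w \<otimes> z = inv v \<otimes> v" unfolding v using assms(1,2) v by (simp add: m_assoc)
  then have "?w \<otimes> z = \<one>" "?w \<in> carrier R" using assms(1,2) by simp_all
  then have "z \<in> Units R" using m_comm[of ?w z] unfolding Units_def by auto
  then show False using z by simp
qed

lemma ord_unit_power:
  assumes "u \<in> Units R"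
  shows "ord (u \<otimes> z [^] n) = n"
proof -
  have "\<exists>v\<in>Units R. u \<otimes> z [^] n = v \<otimes> z [^] ord (u \<otimes> z [^] n)"
    unfolding ord_def by (rule someI[of _ n]) (use assms in blast)
  then show ?thesis using unit_power_unique assms by (metis le_antisym)
qed

lemma ordE:
  assumes "a \<in> carrier R" "a \<noteq> \<zero>"
  obtains u where "u \<in> Units R" "a = u \<otimes> z [^] ord a"
  using unit_times_power[OF assms] ord_unit_power that by metis

lemma ord_mult:
  assumes "a \<in> carrier R - {\<zero>}" "b \<in> carrier R - {\<zero>}"
  shows "ord (a \<otimes> b) = ord a + ord b"
proof -
  obtain u where u: "u \<in> Units R" "a = u \<otimes> z [^] ord a" using ordE assms by blast
  obtain v where v: "v \<in> Units R" "b = v \<otimes> z [^] ord b" using ordE assms by blast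
  have "a \<otimes> b = (u \<otimes> v) \<otimes> z [^] (ord a + ord b)" using unit_power_mult[OF u(1) v(1)] u(2) v(2) by metis
  then show ?thesis using ord_unit_power[of "u \<otimes> v"] u v by simp
qed

lemma ord_add_ge:
  assumes "a \<in> carrier R - {\<zero>}" "b \<in> carrier R - {\<zero>}" "ord a \<le> ord b" "a \<oplus> b \<noteq> \<zero>"
  shows "ord a \<le> ord (a \<oplus> b)"
proof -
  obtain u where u: "u \<in> Units R" "a = u \<otimes> z [^] ord a" using ordE assms by blast
  obtain v where v: "v \<in> Units R" "b = v \<otimes> z [^] ord b" using ordE assms by blast
  define d where "d = ord b - ord a"
  have "b = (v \<otimes> z [^] d) \<otimes> z [^] ord a"
    using v z assms(3) by (subst v(2)) (simp add: d_def m_assoc nat_pow_mult)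
  then have e: "a \<oplus> b = (u \<oplus> v \<otimes> z [^] d) \<otimes> z [^] ord a"
    using u v z l_distr[of u "v \<otimes> z [^] d" "z [^] ord a"] by (metis Units_closed m_closed nat_pow_closed)
  have c: "u \<oplus> v \<otimes> z [^] d \<in> carrier R" using u v z by simp
  have nz: "u \<oplus> v \<otimes> z [^] d \<noteq> \<zero>"
  proof
    assume "u \<oplus> v \<otimes> z [^] d = \<zero>"
    then have "a \<oplus> b = \<zero>" using e z by simp
    then show False using assms(4) by simp
  qed
  obtain w where w: "w \<in> Units R" "u \<oplus> v \<otimes> z [^] d = w \<otimes> z [^] ord (u \<oplus> v \<otimes> z [^] d)"
    using ordE[OF c nz] .
  define n where "n = ord (u \<oplus> v \<otimes> z [^] d)"
  have "a \<oplus> b = w \<otimes> z [^] (n + ord a)"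
    unfolding e using w z by (simp add: n_def[symmetric] m_assoc nat_pow_mult)
  then show ?thesis using ord_unit_power[OF w(1)] by simp
qed

lemma ord_add:
  assumes "a \<in> carrier R - {\<zero>}" "b \<in> carrier R - {\<zero>}" "a \<oplus> b \<noteq> \<zero>"
  shows "min (ord a) (ord b) \<le> ord (a \<oplus> b)"
  using ord_add_ge[OF assms(1,2) _ assms(3)] ord_add_ge[OF assms(2,1)] assms a_comm[of a b]
  by (cases "ord a \<le> ord b") (auto simp: min_def)

text \<open>
  The value of a fraction is defined through a chosen representative; \<open>val_frac\<close> below shows that the
  choice does not matter.
\<close>
definition val :: "('a \<times> 'a) set \<Rightarrow> int" where
  "val X = (let (a, s) = (SOME (a, s). a \<in> carrier R \<and> s \<in> carrier R - {\<zero>} \<and>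
       X = frac_class R (carrier R - {\<zero>}) a s) in int (ord a) - int (ord s))"

lemma nonzero_submonoid: "submonoid (carrier R - {\<zero>}) R"
  using prime_complement_submonoid[OF dom.zeroprimeideal] .

lemma val_frac:
  assumes a: "a \<in> carrier R - {\<zero>}" and s: "s \<in> carrier R - {\<zero>}"
  shows "val (frac_class R (carrier R - {\<zero>}) a s) = int (ord a) - int (ord s)"
proof -
  let ?T = "carrier R - {\<zero>}"
  let ?P = "\<lambda>(b, t). b \<in> carrier R \<and> t \<in> ?T \<and> frac_class R ?T a s = frac_class R ?T b t"
  obtain b t where bt: "(SOME p. ?P p) = (b, t)" by (cases "SOME p. ?P p") auto
  have "?P (SOME p. ?P p)" by (rule someI[of ?P "(a, s)"]) (use a s in auto)
  then have b: "b \<in> carrier R" "t \<in> ?T" "frac_class R ?T a s = frac_class R ?T b t"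
    unfolding bt by auto
  then obtain u where u: "u \<in> ?T" "u \<otimes> (t \<otimes> a) = u \<otimes> (s \<otimes> b)"
    using frac_eq_iff[OF nonzero_submonoid, of a s b t] a s by auto
  then have e: "t \<otimes> a = s \<otimes> b" using dom.m_lcancel[of u] a s b by auto
  moreover have "t \<otimes> a \<noteq> \<zero>" using dom.integral_iff[of t a] a b by simp
  ultimately have "b \<noteq> \<zero>" using s by auto
  then have "ord t + ord a = ord s + ord b"
    using ord_mult[of t a] ord_mult[of s b] e a b s by simp
  then show ?thesis unfolding val_def bt by (simp add: case_prod_beta bt)
qed

lemma is_discrete_valuation_domain: "discrete_valuation_domain R"
proof -
  let ?T = "carrier R - {\<zero>}" and ?K = "fraction_field R"
  let ?f = "frac_class R ?T"
  note sm = nonzero_submonoid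
  have one: "\<one> \<in> ?T" by (rule S_one[OF sm])
  note mult = mult_frac[OF sm, folded fraction_field_def]
    and add = add_frac[OF sm, folded fraction_field_def]
    and cK = carrier_localization[OF sm, folded fraction_field_def]
    and eq = frac_eq_iff[OF sm]
  have zero: "\<zero>\<^bsub>?K\<^esub> = ?f \<zero> \<one>" by (simp add: fraction_field_def localization_def)
  have Tm: "s \<otimes> t \<in> ?T" if "s \<in> ?T" "t \<in> ?T" for s t using S_mult[OF sm that] .
  have zero_iff: "?f a s = \<zero>\<^bsub>?K\<^esub> \<longleftrightarrow> a = \<zero>" if as: "a \<in> carrier R" "s \<in> ?T" for a s
  proof
    assume "?f a s = \<zero>\<^bsub>?K\<^esub>"
    then obtain u where "u \<in> ?T" "u \<otimes> (\<one> \<otimes> a) = u \<otimes> (s \<otimes> \<zero>)"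
      using eq[of a s \<zero> \<one>] as one zero by auto
    then show "a = \<zero>" using as dom.integral_iff[of u a] by auto
  next
    assume "a = \<zero>"
    then show "?f a s = \<zero>\<^bsub>?K\<^esub>"
      unfolding zero using as one by (subst eq) auto
  qed
  have nonzero: "\<exists>a\<in>?T. \<exists>s\<in>?T. x = ?f a s" if "x \<in> carrier ?K - {\<zero>\<^bsub>?K\<^esub>}" for x
    using that zero_iff unfolding cK by auto
  have "discrete_valuation ?K val"
    unfolding discrete_valuation_def
  proof (intro conjI ballI impI)
    fix x y assume x: "x \<in> carrier ?K - {\<zero>\<^bsub>?K\<^esub>}" and y: "y \<in> carrier ?K - {\<zero>\<^bsub>?K\<^esub>}"
    obtain a s where a: "a \<in> ?T" "s \<in> ?T" "x = ?f a s" using nonzero[OF x] by blast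
    obtain b t where b: "b \<in> ?T" "t \<in> ?T" "y = ?f b t" using nonzero[OF y] by blast
    have vx: "val x = int (ord a) - int (ord s)" and vy: "val y = int (ord b) - int (ord t)"
      using val_frac a b by auto
    have "x \<otimes>\<^bsub>?K\<^esub> y = ?f (a \<otimes> b) (s \<otimes> t)" using mult a b by simp
    then show "val (x \<otimes>\<^bsub>?K\<^esub> y) = val x + val y"
      using val_frac[OF Tm[OF a(1) b(1)] Tm[OF a(2) b(2)]] ord_mult[OF a(1) b(1)] ord_mult[OF a(2) b(2)] vx vy
      by simp
    assume nz: "x \<oplus>\<^bsub>?K\<^esub> y \<noteq> \<zero>\<^bsub>?K\<^esub>"
    let ?c = "t \<otimes> a \<oplus> s \<otimes> b"
    have xy: "x \<oplus>\<^bsub>?K\<^esub> y = ?f ?c (s \<otimes> t)" using add a b by simp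
    have cc: "?c \<in> carrier R" using a b by auto
    then have c: "?c \<in> ?T" using nz zero_iff[OF cc Tm[OF a(2) b(2)]] xy by auto
    have "min (ord (t \<otimes> a)) (ord (s \<otimes> b)) \<le> ord ?c"
      using ord_add[OF Tm[OF b(2) a(1)] Tm[OF a(2) b(1)]] c by simp
    then show "min (val x) (val y) \<le> val (x \<oplus>\<^bsub>?K\<^esub> y)"
      using val_frac[OF c Tm[OF a(2) b(2)]] xy ord_mult[OF b(2) a(1)] ord_mult[OF a(2) b(1)]
        ord_mult[OF a(2) b(2)] vx vy by simp
  next
    have "k \<in> val ` (carrier ?K - {\<zero>\<^bsub>?K\<^esub>})" for k :: int
    proof -
      have p: "z [^] n \<in> ?T" "ord (z [^] n) = n" for n :: nat
        using z z_pow[of n] ord_unit_power[of \<one> n] by auto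
      let ?x = "?f (z [^] nat k) (z [^] nat (- k))"
      have "val ?x = k" using val_frac[OF p(1) p(1)] p(2) by simp
      moreover have "?x \<in> carrier ?K" unfolding cK using p(1) by blast
      moreover have "?x \<noteq> \<zero>\<^bsub>?K\<^esub>" using zero_iff[of "z [^] nat k" "z [^] nat (- k)"] p(1) by auto
      ultimately show ?thesis by (metis DiffI imageI singletonD)
    qed
    then show "val ` (carrier ?K - {\<zero>\<^bsub>?K\<^esub>}) = UNIV" by blast
  qed
  moreover have "(\<lambda>a. ?f a \<one>) ` carrier R = {x \<in> carrier ?K. x = \<zero>\<^bsub>?K\<^esub> \<or> 0 \<le> val x}"
  proof (intro equalityI subsetI)
    fix x assume "x \<in> (\<lambda>a. ?f a \<one>) ` carrier R"
    then obtain a where a: "a \<in> carrier R" "x = ?f a \<one>" by blast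
    have "ord \<one> = 0" using ord_unit_power[of \<one> 0] by simp
    then have "x = \<zero>\<^bsub>?K\<^esub> \<or> 0 \<le> val x"
      using zero_iff[OF a(1) one] val_frac[of a \<one>] a one by (cases "a = \<zero>") auto
    moreover have "x \<in> carrier ?K" unfolding cK using a one by blast
    ultimately show "x \<in> {x \<in> carrier ?K. x = \<zero>\<^bsub>?K\<^esub> \<or> 0 \<le> val x}" by simp
  next
    fix x assume x: "x \<in> {x \<in> carrier ?K. x = \<zero>\<^bsub>?K\<^esub> \<or> 0 \<le> val x}"
    show "x \<in> (\<lambda>a. ?f a \<one>) ` carrier R"
    proof (cases "x = \<zero>\<^bsub>?K\<^esub>")
      case True
      then show ?thesis unfolding zero by blast
    next
      case False
      then obtain a s where a: "a \<in> ?T" "s \<in> ?T" "x = ?f a s" using nonzero[of x] x by blast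
      then have le: "ord s \<le> ord a" using False x val_frac by simp
      obtain u where u: "u \<in> Units R" "a = u \<otimes> z [^] ord a" using ordE a by blast
      obtain w where w: "w \<in> Units R" "s = w \<otimes> z [^] ord s" using ordE a by blast
      define d where "d = ord a - ord s"
      let ?c = "u \<otimes> inv w \<otimes> z [^] d"
      have c: "?c \<in> carrier R" using u w z by simp
      have "s \<otimes> ?c = (w \<otimes> z [^] ord s) \<otimes> (u \<otimes> inv w \<otimes> z [^] d)" by (rule arg_cong[OF w(2)])
      also have "\<dots> = (w \<otimes> inv w) \<otimes> (u \<otimes> z [^] (ord s + d))"
        using u w(1) z unit_power_mult[of w "u \<otimes> inv w" "ord s" d] by (simp add: m_ac del: Units_r_inv Units_l_inv)
      also have "\<dots> = a" using w(1) u(2)[symmetric] le a(1) by (simp add: d_def)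
      finally have "s \<otimes> ?c = a" .
      then have "?f a s = ?f ?c \<one>"
        using a c one by (subst eq) auto
      then show ?thesis using a(3) c by blast
    qed
  qed
  ultimately show ?thesis unfolding discrete_valuation_domain_def using is_domain by blast
qed

end

lemma SSP_local_cring_cases:
  assumes loc: "local_cring R" and SSP: "SSP_ring R"
  shows "discrete_valuation_domain R \<or> special_primary_ring R"
proof (cases "\<exists>P. primeideal P R \<and> P \<noteq> nonunits R")
  case True
  interpret local_cring R by (rule loc)
  obtain z where z: "z \<in> nonunits R" "nonunits R = PIdl\<^bsub>R\<^esub> z" "\<And>n::nat. z [^]\<^bsub>R\<^esub> n \<noteq> \<zero>\<^bsub>R\<^esub>"
    using True SSP_uniformizer[OF SSP] by metis
  have "uniformizer R z"
    by (intro uniformizer.intro uniformizer_axioms.intro is_cring z(3) SSP_unit_times_power[OF SSP z])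
      (use z(1) in \<open>auto simp: nonunits_def\<close>)
  then show ?thesis by (simp add: uniformizer.is_discrete_valuation_domain)
next
  case False
  then show ?thesis using local_cring.SSP_special_primary[OF loc SSP] by blast
qed

theorem theorem3p3:
  fixes A :: "('a, 'b) ring_scheme"
  assumes "cring A" and "SSP_ring A"
  shows "almost_multiplication_ring A"
  unfolding almost_multiplication_ring_def
proof (intro conjI allI impI assms(1))
  interpret cring A by (rule assms(1))
  fix P assume "primeideal P A"
  then interpret L: prime_localization A "localization_at A P"
    "\<lambda>a. frac_class A (carrier A - P) a \<one>\<^bsub>A\<^esub>" P
    by (rule prime_localization_at)
  show "discrete_valuation_domain (localization_at A P) \<or> special_primary_ring (localization_at A P)"
    by (rule SSP_local_cring_cases[OF L.local_cring_image L.SSP_ring_image[OF assms(2)]])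
qed

end
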